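(* Let $n\ge 2$ and let $\Omega\subsetneq\mathbb{R}^n$ be a domain. Then: (i) for every $a\in\Omega$ and every $0<r<\frac{1}{100}$, the quasihyperbolic ball $B_Q(a,r)\subset\Omega$ is strictly convex; (ii) if $x,y\in\Omega$ satisfy $d_Q(x,y)<\frac{1}{50}$, then there is only one quasihyperbolic geodesic between $x$ and $y$.
   Context: For a domain $\Omega\subsetneq\mathbb{R}^n$, let $d(z,\partial\Omega)$ be the Euclidean distance from $z$ to $\partial\Omega$. The quasihyperbolic length of a rectifiable curve $\gamma\subset\Omega$ is $l_Q(\gamma)=\int_\gamma \frac{|dz|}{d(z,\partial\Omega)}$, and the quasihyperbolic metric is $d_Q(x,y)=\inf l_Q(\gamma)$, the infimum being over all rectifiable curves in $\Omega$ joining $x$ and $y$. $B_Q(a,r)=\{z\in\Omega: d_Q(a,z)<r\}$. A quasihyperbolic geodesic between $x$ and $y$ is a rectifiable curve in $\Omega$ joining $x$ and $y$ with $l_Q(\gamma)=d_Q(x,y)$; geodesics differing only by parametrization are identified. A set $G\subset\mathbb{R}^n$ is strictly convex if for all distinct $p,q\in\overline{G}$ the open line segment between $p$ and $q$ is contained in the interior of $G$. *)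

theory Defs
  imports "HOL-Analysis.Analysis"
begin

text \<open>Lengths of inscribed polygons of \<open>g\<close> restricted to the parameter interval from \<open>a\<close> to \<open>b\<close>.\<close>

definition chord_sums :: "(real \<Rightarrow> 'a::metric_space) \<Rightarrow> real \<Rightarrow> real \<Rightarrow> real set" where
  "chord_sums g a b =
     {(\<Sum>i<n. dist (g (t i)) (g (t (Suc i)))) | (n::nat) (t::nat \<Rightarrow> real).
        t 0 = a \<and> t n = b \<and> (\<forall>i<n. t i \<le> t (Suc i))}"

definition rectifiable_path :: "(real \<Rightarrow> 'a::metric_space) \<Rightarrow> bool" where
  "rectifiable_path g \<longleftrightarrow> path g \<and> bdd_above (chord_sums g 0 1)"

text \<open>The supremum is the true length only where it is finite, as on every subinterval of
  \<open>[0,1]\<close> for a rectifiable path.\<close>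

definition curve_length :: "(real \<Rightarrow> 'a::metric_space) \<Rightarrow> real \<Rightarrow> real \<Rightarrow> real" where
  "curve_length g a b = Sup (chord_sums g a b)"

text \<open>For a rectifiable path the length function \<open>t \<mapsto> curve_length g 0 t\<close> is continuous, so
  every \<open>u\<close> between \<open>0\<close> and the total length is attained, and \<open>g\<close> is constant wherever
  the length function is; hence the value does not depend on the choice of \<open>t\<close>.\<close>

definition arclength_param :: "(real \<Rightarrow> 'a::metric_space) \<Rightarrow> real \<Rightarrow> 'a" where
  "arclength_param g u = g (SOME t. t \<in> {0..1} \<and> curve_length g 0 t = u)"

text \<open>The line integral of \<open>f\<close> along \<open>g\<close> with respect to arc length \<open>|dz|\<close>.\<close>

definition arclength_integral :: "('a::metric_space \<Rightarrow> real) \<Rightarrow> (real \<Rightarrow> 'a) \<Rightarrow> real" where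
  "arclength_integral f g =
     integral {0..curve_length g 0 1} (\<lambda>u. f (arclength_param g u))"

definition qh_length :: "'a::euclidean_space set \<Rightarrow> (real \<Rightarrow> 'a) \<Rightarrow> real" where
  "qh_length \<Omega> g = arclength_integral (\<lambda>z. 1 / infdist z (frontier \<Omega>)) g"

definition qh_paths :: "'a::euclidean_space set \<Rightarrow> 'a \<Rightarrow> 'a \<Rightarrow> (real \<Rightarrow> 'a) set" where
  "qh_paths \<Omega> x y =
     {g. rectifiable_path g \<and> path_image g \<subseteq> \<Omega> \<and> pathstart g = x \<and> pathfinish g = y}"

definition qh_dist :: "'a::euclidean_space set \<Rightarrow> 'a \<Rightarrow> 'a \<Rightarrow> real" where
  "qh_dist \<Omega> x y = (INF g\<in>qh_paths \<Omega> x y. qh_length \<Omega> g)"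

definition qh_ball :: "'a::euclidean_space set \<Rightarrow> 'a \<Rightarrow> real \<Rightarrow> 'a set" where
  "qh_ball \<Omega> a r = {z \<in> \<Omega>. qh_dist \<Omega> a z < r}"

definition qh_geodesic :: "'a::euclidean_space set \<Rightarrow> 'a \<Rightarrow> 'a \<Rightarrow> (real \<Rightarrow> 'a) \<Rightarrow> bool" where
  "qh_geodesic \<Omega> x y g \<longleftrightarrow> g \<in> qh_paths \<Omega> x y \<and> qh_length \<Omega> g = qh_dist \<Omega> x y"

text \<open>Two paths differ only by parametrization if they agree after monotone, not necessarily
  injective, reparametrizations of both.  A single homeomorphic change of parameter would
  separate a path from a copy of it that rests at a point for some time.\<close>

definition monotone_reparam :: "(real \<Rightarrow> real) \<Rightarrow> bool" where
  "monotone_reparam \<phi> \<longleftrightarrow>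
     continuous_on {0..1} \<phi> \<and> mono_on {0..1} \<phi> \<and> \<phi> ` {0..1} = {0..1}"

definition same_up_to_param :: "(real \<Rightarrow> 'a) \<Rightarrow> (real \<Rightarrow> 'a) \<Rightarrow> bool" where
  "same_up_to_param g h \<longleftrightarrow>
     (\<exists>\<phi> \<psi>. monotone_reparam \<phi> \<and> monotone_reparam \<psi> \<and> (\<forall>t\<in>{0..1}. g (\<phi> t) = h (\<psi> t)))"

definition strictly_convex :: "'a::euclidean_space set \<Rightarrow> bool" where
  "strictly_convex G \<longleftrightarrow>
     (\<forall>p\<in>closure G. \<forall>q\<in>closure G. p \<noteq> q \<longrightarrow> open_segment p q \<subseteq> interior G)"

end

theory Submission
  imports Defs
begin

text \<open>Write \<open>\<delta>\<close> for the distance to the boundary. By the parallelogram law, \<open>\<delta>\<^sup>2\<close> at a midpoint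
  is at least the average of \<open>\<delta>\<^sup>2\<close> minus a quarter of the squared distance of the end points.
  Let \<open>p\<close>, \<open>q\<close> have quasihyperbolic distance less than \<open>k\<close> from \<open>a\<close>; join them to \<open>a\<close> by chains
  \<open>x\<^sub>i\<close>, \<open>y\<^sub>i\<close> of \<open>N\<close> steps of quasihyperbolic size at most \<open>k/N\<close>, and compare with the chain of
  midpoints \<open>m\<^sub>i\<close>. With \<open>w\<^sub>i = x\<^sub>i - y\<^sub>i\<close> the parallelogram law for the steps gives, up to lower order terms,
  \<open>|m\<^sub>i\<^sub>+\<^sub>1 - m\<^sub>i|\<^sup>2 / \<delta>(m\<^sub>i)\<^sup>2 \<le> (k/N)\<^sup>2 + ((k/N)\<^sup>2 |w\<^sub>i|\<^sup>2 - |w\<^sub>i\<^sub>+\<^sub>1 - w\<^sub>i|\<^sup>2) / (4 \<delta>(m\<^sub>i)\<^sup>2)\<close>.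
  As \<open>w\<^sub>0 = 0\<close>, a discrete Poincare inequality makes the gain dominate the loss for small \<open>k\<close>, and
  \<open>N \<rightarrow> \<infinity>\<close> shows that the midpoint of \<open>p \<noteq> q\<close> is strictly closer to \<open>a\<close> than the
  farther one of \<open>p\<close>, \<open>q\<close>. This excludes interior maxima of the distance to \<open>a\<close> along
  segments, and two distinct points at distances \<open>u\<close> from \<open>x\<close> and \<open>d(x,y) - u\<close> from \<open>y\<close>.\<close>

section \<open>Length of rectifiable paths\<close>

lemma chord_sums_dist:
  assumes "a \<le> b"
  shows "dist (g a) (g b) \<in> chord_sums g a b"
  unfolding chord_sums_def
  by (rule CollectI, rule exI[of _ 1], rule exI[of _ "\<lambda>i. if i = 0 then a else b"])
    (use assms in auto)

lemma chord_sums_append: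
  assumes "x \<in> chord_sums g a s" "s \<le> t"
  shows "x + dist (g s) (g t) \<in> chord_sums g a t"
proof -
  obtain n u where u: "x = (\<Sum>i<n. dist (g (u i)) (g (u (Suc i))))" "u 0 = a" "u n = s"
      "\<forall>i<n. u i \<le> u (Suc i)"
    using assms by (auto simp: chord_sums_def)
  have *: "(\<Sum>i<n. dist (g ((u(Suc n := t)) i)) (g ((u(Suc n := t)) (Suc i)))) = x"
    unfolding u(1) by (rule sum.cong) auto
  show ?thesis
    unfolding chord_sums_def
  proof (rule CollectI, intro exI conjI)
    show "x + dist (g s) (g t) = (\<Sum>i<Suc n. dist (g ((u(Suc n := t)) i)) (g ((u(Suc n := t)) (Suc i))))"
      using * u by simp
  qed (use u assms in \<open>auto simp: less_Suc_eq\<close>)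
qed

lemma partition_mono:
  fixes u :: "nat \<Rightarrow> real"
  assumes "\<forall>i<n. u i \<le> u (Suc i)" "i \<le> j" "j \<le> n"
  shows "u i \<le> u j"
  using assms(2,3)
proof (induction j rule: dec_induct)
  case (step j)
  then show ?case
    using assms(1) by (meson Suc_le_eq less_imp_le order_trans)
qed simp

text \<open>Telescoping along the partition. Upper estimates of length below come from exhibiting a
  function \<open>m\<close> whose increments dominate the chords.\<close>

lemma chord_sums_le:
  assumes "\<And>s t. a \<le> s \<Longrightarrow> s \<le> t \<Longrightarrow> t \<le> b \<Longrightarrow> dist (g s) (g t) \<le> m t - m s"
    and "x \<in> chord_sums g a b"
  shows "x \<le> m b - (m a :: real)"
proof -
  obtain n u where u: "x = (\<Sum>i<n. dist (g (u i)) (g (u (Suc i))))" "u 0 = a" "u n = b"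
      "\<forall>i<n. u i \<le> u (Suc i)"
    using assms by (auto simp: chord_sums_def)
  note mono = partition_mono[OF u(4)]
  have "x \<le> (\<Sum>i<n. m (u (Suc i)) - m (u i))"
    unfolding u(1)
  proof (rule sum_mono)
    fix i assume "i \<in> {..<n}"
    then show "dist (g (u i)) (g (u (Suc i))) \<le> m (u (Suc i)) - m (u i)"
      using mono[of 0 i] mono[of i "Suc i"] mono[of "Suc i" n] u by (intro assms) auto
  qed
  also have "\<dots> = m b - m a"
    using sum_lessThan_telescope[of "\<lambda>i. m (u i)" n] u by simp
  finally show ?thesis .
qed

lemma curve_length_le:
  assumes "a \<le> b"
    and "\<And>s t. a \<le> s \<Longrightarrow> s \<le> t \<Longrightarrow> t \<le> b \<Longrightarrow> dist (g s) (g t) \<le> m t - m s"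
  shows "curve_length g a b \<le> m b - (m a :: real)"
  unfolding curve_length_def
proof (rule cSup_least)
  show "chord_sums g a b \<noteq> {}"
    using chord_sums_dist[OF assms(1)] by blast
qed (rule chord_sums_le[OF assms(2)])

lemma curve_length_append:
  assumes "bdd_above (chord_sums g a t)" "a \<le> s" "s \<le> t"
  shows "curve_length g a s + dist (g s) (g t) \<le> curve_length g a t"
proof -
  have "curve_length g a s \<le> curve_length g a t - dist (g s) (g t)"
    unfolding curve_length_def
  proof (rule cSup_least)
    fix x assume "x \<in> chord_sums g a s"
    then show "x \<le> Sup (chord_sums g a t) - dist (g s) (g t)"
      using cSup_upper[OF chord_sums_append assms(1)] assms(3) by fastforce
  qed (use chord_sums_dist[OF assms(2)] in auto)
  then show ?thesis by simp
qed

lemma chord_sums_cong: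
  assumes "\<And>t. a \<le> t \<Longrightarrow> t \<le> b \<Longrightarrow> g t = h t"
  shows "chord_sums g a b = chord_sums h a b"
proof -
  have "chord_sums g a b \<subseteq> chord_sums h a b"
    if eq: "\<And>t. a \<le> t \<Longrightarrow> t \<le> b \<Longrightarrow> g t = h t" for g h :: "real \<Rightarrow> 'a"
  proof
    fix x assume "x \<in> chord_sums g a b"
    then obtain n u where u: "x = (\<Sum>i<n. dist (g (u i)) (g (u (Suc i))))" "u 0 = a" "u n = b"
      "\<forall>i<n. u i \<le> u (Suc i)"
      by (auto simp: chord_sums_def)
    note mono = partition_mono[OF u(4)]
    have "g (u i) = h (u i)" if "i \<le> n" for i
      using mono[of 0 i] mono[of i n] that u by (intro eq) auto
    then have "x = (\<Sum>i<n. dist (h (u i)) (h (u (Suc i))))"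
      unfolding u(1) by (intro sum.cong) auto
    then show "x \<in> chord_sums h a b"
      using u by (auto simp: chord_sums_def)
  qed
  from this[of g h] this[of h g] assms show ?thesis by auto
qed

lemma rectifiable_pathI:
  assumes "path g"
    and "\<And>s t. 0 \<le> s \<Longrightarrow> s \<le> t \<Longrightarrow> t \<le> 1 \<Longrightarrow> dist (g s) (g t) \<le> m t - (m s :: real)"
  shows "rectifiable_path g"
  unfolding rectifiable_path_def
proof
  show "bdd_above (chord_sums g 0 1)"
    by (rule bdd_aboveI[of _ "m 1 - m 0"], rule chord_sums_le[OF assms(2)])
qed (rule assms(1))

text \<open>The length function is itself an admissible \<open>m\<close> for
  \<open>curve_length_le\<close>, so the two facts together make it the least function dominating
  the chords. This minimality drives the arguments about attained values, subpaths and
  reversal.\<close>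

lemma dist_le_curve_length_diff:
  assumes "rectifiable_path g" "0 \<le> s" "s \<le> t" "t \<le> 1"
  shows "dist (g s) (g t) \<le> curve_length g 0 t - curve_length g 0 s"
proof -
  have "bdd_above (chord_sums g 0 t)"
  proof -
    obtain M where M: "\<And>x. x \<in> chord_sums g 0 1 \<Longrightarrow> x \<le> M"
      using assms(1) by (auto simp: rectifiable_path_def bdd_above_def)
    \<comment> \<open>Appending the chord from \<open>t\<close> to \<open>1\<close> turns a polygon
      on the initial piece into one on the whole interval.\<close>
    have "x \<le> M" if "x \<in> chord_sums g 0 t" for x
      using M[OF chord_sums_append[OF that assms(4)]] zero_le_dist[of "g t" "g 1"] by linarith
    then show ?thesis by (rule bdd_aboveI)
  qed
  then show ?thesis
    using curve_length_append[of g 0 t s] assms by simp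
qed

lemma curve_length_refl: "curve_length g a a = 0"
proof (rule antisym)
  have bdd: "x \<le> 0 - 0" if "x \<in> chord_sums g a a" for x
  proof (rule chord_sums_le[OF _ that])
    fix s t :: real assume "a \<le> s" "s \<le> t" "t \<le> a"
    then have "s = t" by linarith
    then show "dist (g s) (g t) \<le> 0 - 0" by simp
  qed
  then have "bdd_above (chord_sums g a a)"
    by (intro bdd_aboveI[of _ 0]) simp
  show "curve_length g a a \<le> 0"
    unfolding curve_length_def
    by (rule cSup_least) (use chord_sums_dist[of a a g] bdd in auto)
  show "0 \<le> curve_length g a a"
    unfolding curve_length_def using chord_sums_dist[of a a g] \<open>bdd_above _\<close>
    by (intro cSup_upper) auto
qed

lemma curve_length_mono:
  assumes "rectifiable_path g" "0 \<le> s" "s \<le> t" "t \<le> 1"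
  shows "curve_length g 0 s \<le> curve_length g 0 t"
  using dist_le_curve_length_diff[OF assms] zero_le_dist[of "g s" "g t"] by linarith

lemma curve_length_nonneg:
  assumes "rectifiable_path g" "0 \<le> t" "t \<le> 1"
  shows "0 \<le> curve_length g 0 t"
  using curve_length_mono[of g 0 t] assms by (simp add: curve_length_refl)

lemma curve_length_between:
  assumes g: "rectifiable_path g" and "0 \<le> a" "a \<le> b" "b \<le> 1"
  shows "curve_length g a b = curve_length g 0 b - curve_length g 0 a"
proof (rule antisym)
  let ?V = "curve_length g 0"
  show "curve_length g a b \<le> ?V b - ?V a"
    using assms by (intro curve_length_le dist_le_curve_length_diff) auto
  \<comment> \<open>Pasting the length up to \<open>a\<close> with the length counted afresh from
    \<open>a\<close> gives a function that dominates all chords, a chord across \<open>a\<close>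
    being split by the triangle inequality. Minimality of \<open>?V\<close> yields the other
    inequality.\<close>
  define m where "m = (\<lambda>t. if t \<le> a then ?V t else ?V a + curve_length g a t)"
  have m: "m t = ?V a + curve_length g a t" if "a \<le> t" for t
    using that by (auto simp: m_def curve_length_refl)
  have bdd: "bdd_above (chord_sums g a t)" if "t \<le> 1" for t
    using chord_sums_le[of a t g ?V] dist_le_curve_length_diff[OF g] assms that
    by (intro bdd_aboveI[of _ "?V t - ?V a"]) auto
  have right: "dist (g s) (g t) \<le> m t - m s" if "a \<le> s" "s \<le> t" "t \<le> b" for s t
    using curve_length_append[OF bdd, of t s] that assms by (auto simp: m)
  have "?V b \<le> m b - m 0"
  proof (rule curve_length_le)
    fix s t assume st: "0 \<le> s" "s \<le> t" "t \<le> b"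
    consider "t \<le> a" | "s \<le> a" "a \<le> t" | "a \<le> s" by linarith
    then show "dist (g s) (g t) \<le> m t - m s"
    proof cases
      case 1
      then show ?thesis
        using st dist_le_curve_length_diff[OF g, of s t] assms by (simp add: m_def)
    next
      case 2
      have "dist (g s) (g t) \<le> dist (g s) (g a) + dist (g a) (g t)"
        by (rule dist_triangle)
      moreover have "dist (g s) (g a) \<le> m a - m s"
        using 2 st dist_le_curve_length_diff[OF g, of s a] assms by (simp add: m_def)
      ultimately show ?thesis
        using right[of a t] 2 st by simp
    next
      case 3
      then show ?thesis using right st by simp
    qed
  qed (use assms in auto)
  then show "?V b - ?V a \<le> curve_length g a b"
    using assms by (simp add: m m_def[THEN fun_cong, of 0] curve_length_refl)
qed

text \<open>A value omitted by the length function would be skipped by a jump of it; but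
  subtracting the jump leaves a function that still dominates all chords, contrary to
  the minimality of the length.\<close>

lemma curve_length_attained:
  assumes g: "rectifiable_path g" and u: "0 \<le> u" "u \<le> curve_length g 0 1"
  obtains t where "0 \<le> t" "t \<le> 1" "curve_length g 0 t = u"
proof -
  define V where "V = curve_length g 0"
  have V0: "V 0 = 0" by (simp add: V_def curve_length_refl)
  have D: "dist (g s) (g t) \<le> V t - V s" if "0 \<le> s" "s \<le> t" "t \<le> 1" for s t
    unfolding V_def using dist_le_curve_length_diff[OF g] that by simp
  have mono: "V s \<le> V t" if "0 \<le> s" "s \<le> t" "t \<le> 1" for s t
    unfolding V_def using curve_length_mono[OF g] that by simp
  have le: "V 1 \<le> m 1 - m 0"
    if "\<And>s t. 0 \<le> s \<Longrightarrow> s \<le> t \<Longrightarrow> t \<le> 1 \<Longrightarrow> dist (g s) (g t) \<le> m t - m s" for m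
    unfolding V_def using that by (intro curve_length_le) auto
  have cont: "\<exists>d>0. \<forall>t'\<in>{0..1}. \<bar>t' - t\<bar> < d \<longrightarrow> dist (g t') (g t) < e"
    if "t \<in> {0..1}" "e > 0" for t e
    using g that unfolding rectifiable_path_def path_def continuous_on_iff
    by (auto simp: dist_real_def)
  have "\<exists>t\<in>{0..1}. V t = u"
  proof (rule ccontr)
    assume "\<not> ?thesis"
    then have no: "V t \<noteq> u" if "0 \<le> t" "t \<le> 1" for t
      using that by auto
    define T where "T = {t \<in> {0..1}. V t < u}"
    \<comment> \<open>The place of the jump: the length function is below \<open>u\<close> before
      \<open>\<tau>\<close> and above \<open>u\<close> after it.\<close>
    define \<tau> where "\<tau> = Sup T"
    have "0 \<in> T" using u no[of 0] V0 by (auto simp: T_def)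
    have bT: "bdd_above T" by (auto simp: T_def intro: bdd_aboveI[of _ 1])
    have \<tau>: "0 \<le> \<tau>" "\<tau> \<le> 1"
      unfolding \<tau>_def using \<open>0 \<in> T\<close> bT
      by (auto intro: cSup_upper intro!: cSup_least simp: T_def)
    have below: "V t < u" if t: "0 \<le> t" "t < \<tau>" for t
    proof -
      obtain s where "s \<in> T" "t < s"
        using t \<open>0 \<in> T\<close> bT unfolding \<tau>_def by (metis empty_iff less_cSup_iff)
      then show ?thesis using mono[of t s] t by (auto simp: T_def)
    qed
    have above: "u < V t" if t: "\<tau> < t" "t \<le> 1" for t
    proof -
      have "t \<notin> T" using t bT unfolding \<tau>_def by (meson cSup_upper leD)
      then show ?thesis using no[of t] t \<tau> by (auto simp: T_def)
    qed
    show False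
    proof (cases "V \<tau> < u")
      case True
      then have "\<tau> < 1" using u \<tau> by (cases "\<tau> = 1") (auto simp: V_def)
      \<comment> \<open>The values between \<open>V \<tau>\<close> and \<open>u\<close> are skipped
        just after \<open>\<tau>\<close>, so \<open>V\<close> is lowered there by
        \<open>u - V \<tau>\<close>.\<close>
      define m where "m = (\<lambda>t. if t \<le> \<tau> then V t else V t - (u - V \<tau>))"
      \<comment> \<open>By continuity of \<open>g\<close>, some \<open>t'\<close> just after
        \<open>\<tau>\<close> is reached by an arbitrarily short chord, and \<open>V t'\<close>
        already exceeds \<open>u\<close>.\<close>
      have key: "dist (g \<tau>) (g t) \<le> V t - u" if t: "\<tau> < t" "t \<le> 1" for t
      proof (rule field_le_epsilon)
        fix e :: real assume "e > 0"
        then obtain d where d: "d > 0" "\<And>t'. t' \<in> {0..1} \<Longrightarrow> \<bar>t' - \<tau>\<bar> < d \<Longrightarrow> dist (g t') (g \<tau>) < e"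
          using cont[of \<tau> e] \<tau> by auto
        define t' where "t' = min t (\<tau> + d/2)"
        have t': "\<tau> < t'" "t' \<le> t" "\<bar>t' - \<tau>\<bar> < d"
          using t d by (auto simp: t'_def)
        have "dist (g \<tau>) (g t) \<le> dist (g \<tau>) (g t') + dist (g t') (g t)"
          by (rule dist_triangle)
        also have "\<dots> \<le> e + (V t - V t')"
          using d(2)[of t'] D[of t' t] t' t \<tau> by (auto simp: dist_commute intro!: add_mono)
        also have "\<dots> \<le> V t - u + e"
          using above[of t'] t' t by simp
        finally show "dist (g \<tau>) (g t) \<le> V t - u + e" .
      qed
      have "V 1 \<le> m 1 - m 0"
      proof (rule le)
        fix s t :: real assume st: "0 \<le> s" "s \<le> t" "t \<le> 1"
        show "dist (g s) (g t) \<le> m t - m s"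
        proof (cases "s \<le> \<tau> \<and> \<tau> < t")
          case True
          have "dist (g s) (g t) \<le> dist (g s) (g \<tau>) + dist (g \<tau>) (g t)"
            by (rule dist_triangle)
          then show ?thesis
            using D[of s \<tau>] key[of t] st \<tau> True by (simp add: m_def)
        next
          case False
          then show ?thesis using D[of s t] st by (auto simp: m_def)
        qed
      qed
      then show False
        using True \<tau> \<open>\<tau> < 1\<close> V0 by (simp add: m_def)
    next
      case False
      then have "u < V \<tau>" using no \<tau> by force
      then have "0 < \<tau>" using V0 u \<tau> by (cases "\<tau> = 0") auto
      \<comment> \<open>Mirror case: the values between \<open>u\<close> and \<open>V \<tau>\<close>
        are skipped on the way into \<open>\<tau>\<close>, so the lowering starts at
        \<open>\<tau>\<close> itself.\<close>
      define m where "m = (\<lambda>t. if t < \<tau> then V t else V t - (V \<tau> - u))"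
      have key: "dist (g s) (g \<tau>) \<le> u - V s" if s: "0 \<le> s" "s < \<tau>" for s
      proof (rule field_le_epsilon)
        fix e :: real assume "e > 0"
        then obtain d where d: "d > 0" "\<And>t'. t' \<in> {0..1} \<Longrightarrow> \<bar>t' - \<tau>\<bar> < d \<Longrightarrow> dist (g t') (g \<tau>) < e"
          using cont[of \<tau> e] \<tau> by auto
        define t' where "t' = max s (\<tau> - d/2)"
        have t': "t' < \<tau>" "s \<le> t'" "\<bar>t' - \<tau>\<bar> < d"
          using s d by (auto simp: t'_def)
        have "dist (g s) (g \<tau>) \<le> dist (g s) (g t') + dist (g t') (g \<tau>)"
          by (rule dist_triangle)
        also have "\<dots> \<le> (V t' - V s) + e"
          using d(2)[of t'] D[of s t'] t' s \<tau> by (auto intro!: add_mono)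
        also have "\<dots> \<le> u - V s + e"
          using below[of t'] t' s by simp
        finally show "dist (g s) (g \<tau>) \<le> u - V s + e" .
      qed
      have "V 1 \<le> m 1 - m 0"
      proof (rule le)
        fix s t :: real assume st: "0 \<le> s" "s \<le> t" "t \<le> 1"
        show "dist (g s) (g t) \<le> m t - m s"
        proof (cases "s < \<tau> \<and> \<tau> \<le> t")
          case True
          have "dist (g s) (g t) \<le> dist (g s) (g \<tau>) + dist (g \<tau>) (g t)"
            by (rule dist_triangle)
          then show ?thesis
            using D[of \<tau> t] key[of s] st \<tau> True by (simp add: m_def)
        next
          case False
          then show ?thesis using D[of s t] st by (auto simp: m_def)
        qed
      qed
      then show False
        using \<open>u < V \<tau>\<close> \<tau> \<open>0 < \<tau>\<close> V0 by (simp add: m_def)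
    qed
  qed
  then show thesis using that by (auto simp: V_def)
qed

section \<open>Parametrization by arc length and the line integral\<close>

lemma arclength_param_curve_length:
  assumes g: "rectifiable_path g" and t: "0 \<le> t" "t \<le> 1"
  shows "arclength_param g (curve_length g 0 t) = g t"
proof -
  define s where "s = (SOME s. s \<in> {0..1} \<and> curve_length g 0 s = curve_length g 0 t)"
  have s: "s \<in> {0..1} \<and> curve_length g 0 s = curve_length g 0 t"
    unfolding s_def by (rule someI[of _ t]) (use t in auto)
  \<comment> \<open>Whichever parameter is chosen, its length value is that of \<open>t\<close>, so
    the chord between the two points vanishes.\<close>
  have "dist (g s) (g t) \<le> 0"
  proof (cases "s \<le> t")
    case True
    with s t show ?thesis
      using dist_le_curve_length_diff[OF g, of s t] by simp
  next
    case False
    with s t show ?thesis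
      using dist_le_curve_length_diff[OF g, of t s] by (simp add: dist_commute)
  qed
  then show ?thesis
    unfolding arclength_param_def s_def[symmetric] by simp
qed

lemma dist_arclength_param_le:
  assumes g: "rectifiable_path g" and "u \<in> {0..curve_length g 0 1}" "v \<in> {0..curve_length g 0 1}"
  shows "dist (arclength_param g u) (arclength_param g v) \<le> \<bar>u - v\<bar>"
proof -
  obtain s where s: "0 \<le> s" "s \<le> 1" "curve_length g 0 s = u"
    using curve_length_attained[OF g, of u] assms by auto
  obtain t where t: "0 \<le> t" "t \<le> 1" "curve_length g 0 t = v"
    using curve_length_attained[OF g, of v] assms by auto
  show ?thesis
    using arclength_param_curve_length[OF g s(1,2)] arclength_param_curve_length[OF g t(1,2)]
      dist_le_curve_length_diff[OF g, of s t] dist_le_curve_length_diff[OF g, of t s] s t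
    by (cases "s \<le> t") (auto simp: dist_commute)
qed

lemma continuous_on_arclength_param:
  assumes "rectifiable_path g"
  shows "continuous_on {0..curve_length g 0 1} (arclength_param g)"
  unfolding continuous_on_iff
proof (intro ballI allI impI)
  fix u and e :: real
  assume u: "u \<in> {0..curve_length g 0 1}" and e: "0 < e"
  show "\<exists>d>0. \<forall>v\<in>{0..curve_length g 0 1}. dist v u < d \<longrightarrow>
      dist (arclength_param g v) (arclength_param g u) < e"
    using dist_arclength_param_le[OF assms _ u] e by (intro exI[of _ e]) (force simp: dist_real_def)
qed

lemma arclength_param_image:
  assumes "rectifiable_path g"
  shows "arclength_param g ` {0..curve_length g 0 1} = path_image g"
proof
  show "arclength_param g ` {0..curve_length g 0 1} \<subseteq> path_image g"
  proof clarify
    fix u assume "u \<in> {0..curve_length g 0 1}"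
    then obtain t where "0 \<le> t" "t \<le> 1" "curve_length g 0 t = u"
      using curve_length_attained[OF assms, of u] by auto
    then show "arclength_param g u \<in> path_image g"
      using arclength_param_curve_length[OF assms] by (force simp: path_image_def)
  qed
  show "path_image g \<subseteq> arclength_param g ` {0..curve_length g 0 1}"
  proof
    fix x assume "x \<in> path_image g"
    then obtain t where t: "0 \<le> t" "t \<le> 1" "x = g t"
      by (auto simp: path_image_def)
    show "x \<in> arclength_param g ` {0..curve_length g 0 1}"
      using arclength_param_curve_length[OF assms t(1,2)] curve_length_nonneg[OF assms t(1,2)]
        curve_length_mono[OF assms, of t 1] t
      by (intro image_eqI[of _ _ "curve_length g 0 t"]) auto
  qed
qed

text \<open>Frees the integral from the choice operator: every \<open>u\<close> in the range of
  integration is a length value, so any \<open>\<sigma>\<close> that sends length values to the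
  right points may replace \<open>arclength_param g\<close>.\<close>

lemma arclength_integral_eqI:
  assumes g: "rectifiable_path g"
    and "\<And>t. 0 \<le> t \<Longrightarrow> t \<le> 1 \<Longrightarrow> \<sigma> (curve_length g 0 t) = g t"
  shows "arclength_integral f g = integral {0..curve_length g 0 1} (\<lambda>u. f (\<sigma> u))"
  unfolding arclength_integral_def
proof (rule integral_cong)
  fix u assume "u \<in> {0..curve_length g 0 1}"
  then obtain t where "0 \<le> t" "t \<le> 1" "curve_length g 0 t = u"
    using curve_length_attained[OF g, of u] by auto
  then show "f (arclength_param g u) = f (\<sigma> u)"
    using assms(2) arclength_param_curve_length[OF g] by metis
qed

text \<open>Polygons and lengths only see parameters in the unit interval. This is what identifies
  the halves of a joined path with the original paths, with which they agree only there.\<close>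

lemma arclength_integral_cong:
  assumes "\<And>t. 0 \<le> t \<Longrightarrow> t \<le> 1 \<Longrightarrow> g t = h t" and g: "rectifiable_path g"
  shows "arclength_integral f g = arclength_integral f h"
proof -
  have "path g \<longleftrightarrow> path h"
    unfolding path_def using assms by (intro continuous_on_cong) auto
  then have rect: "rectifiable_path g \<longleftrightarrow> rectifiable_path h"
    unfolding rectifiable_path_def using chord_sums_cong[of 0 1 g h] assms by auto
  have V: "curve_length g 0 t = curve_length h 0 t" if "t \<le> 1" for t
    unfolding curve_length_def using chord_sums_cong[of 0 t g h] assms that by auto
  have "arclength_param h (curve_length g 0 t) = g t" if "0 \<le> t" "t \<le> 1" for t
    using arclength_param_curve_length[of h t] rect g V assms that by auto
  from arclength_integral_eqI[OF g this] show "arclength_integral f g = arclength_integral f h"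
    by (simp add: V arclength_integral_def)
qed

section \<open>Length of subpaths, reversed paths and joined paths\<close>

lemma
  assumes g: "rectifiable_path g" and ab: "0 \<le> a" "a \<le> b" "b \<le> 1"
  shows rectifiable_path_subpath: "rectifiable_path (subpath a b g)"
    and curve_length_subpath: "\<And>t. 0 \<le> t \<Longrightarrow> t \<le> 1 \<Longrightarrow>
      curve_length (subpath a b g) 0 t = curve_length g 0 (a + (b - a) * t) - curve_length g 0 a"
proof -
  define \<phi> where "\<phi> = (\<lambda>t. a + (b - a) * t)"
  define p where "p = subpath a b g"
  have p: "p t = g (\<phi> t)" for t
    by (simp add: p_def subpath_def \<phi>_def algebra_simps)
  have \<phi>01: "\<phi> t \<le> b" "0 \<le> \<phi> t" "\<phi> t \<le> 1" "a \<le> \<phi> t" if "0 \<le> t" "t \<le> 1" for t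
  proof -
    have "(b - a) * t \<le> (b - a) * 1" "0 \<le> (b - a) * t"
      using ab that by (intro mult_left_mono mult_nonneg_nonneg; simp)+
    then show "\<phi> t \<le> b" "0 \<le> \<phi> t" "\<phi> t \<le> 1" "a \<le> \<phi> t"
      using ab by (auto simp: \<phi>_def)
  qed
  have \<phi>mono: "\<phi> s \<le> \<phi> t" if "s \<le> t" for s t
    using ab that by (auto simp: \<phi>_def intro: mult_left_mono)
  have D: "dist (p s) (p t) \<le> curve_length g 0 (\<phi> t) - curve_length g 0 (\<phi> s)"
    if "0 \<le> s" "s \<le> t" "t \<le> 1" for s t
    unfolding p using that \<phi>01 \<phi>mono by (intro dist_le_curve_length_diff[OF g]) auto
  have "path p"
    unfolding p_def using g ab by (intro path_subpath) (auto simp: rectifiable_path_def)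
  then show rp: "rectifiable_path (subpath a b g)"
    using rectifiable_pathI[OF _ D] by (simp add: p_def)
  fix t :: real assume t: "0 \<le> t" "t \<le> 1"
  have "curve_length p 0 t = curve_length g 0 (\<phi> t) - curve_length g 0 (\<phi> 0)"
  proof (rule antisym)
    show "curve_length p 0 t \<le> curve_length g 0 (\<phi> t) - curve_length g 0 (\<phi> 0)"
      using curve_length_le[of 0 t p "\<lambda>t. curve_length g 0 (\<phi> t)"] D t by auto
    show "curve_length g 0 (\<phi> t) - curve_length g 0 (\<phi> 0) \<le> curve_length p 0 t"
    proof (cases "a = b")
      case True
      then show ?thesis
        using curve_length_nonneg[OF rp] t by (simp add: \<phi>_def p_def)
    next
      case False
      define \<psi> where "\<psi> = (\<lambda>t. (t - a) / (b - a))"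
      have \<psi>: "\<phi> (\<psi> s) = s" "\<psi> (\<phi> s) = s" for s
        using False by (auto simp: \<phi>_def \<psi>_def)
      have \<psi>mono: "\<psi> s \<le> \<psi> s'" if "s \<le> s'" for s s'
        using that ab by (auto simp: \<psi>_def intro: divide_right_mono)
      \<comment> \<open>The length function of \<open>p\<close>, pulled back by the inverse
        \<open>\<psi>\<close> of \<open>\<phi>\<close>, dominates the chords of \<open>g\<close>, so
        the length of \<open>g\<close> is no larger.\<close>
      have "curve_length g a (\<phi> t) \<le> curve_length p 0 (\<psi> (\<phi> t)) - curve_length p 0 (\<psi> a)"
      proof (rule curve_length_le)
        fix s s' assume s: "a \<le> s" "s \<le> s'" "s' \<le> \<phi> t"
        have "dist (p (\<psi> s)) (p (\<psi> s')) \<le> curve_length p 0 (\<psi> s') - curve_length p 0 (\<psi> s)"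
          using s \<psi>mono[of s' "\<phi> t"] \<psi>mono[of s s'] \<psi>mono[of a s] t
          by (intro dist_le_curve_length_diff) (auto simp: p_def rp \<psi> \<psi>_def[THEN fun_cong, of a])
        then show "dist (g s) (g s') \<le> curve_length p 0 (\<psi> s') - curve_length p 0 (\<psi> s)"
          by (simp add: p \<psi>)
      qed (use \<phi>01 t in auto)
      moreover have "curve_length g a (\<phi> t) = curve_length g 0 (\<phi> t) - curve_length g 0 a"
        using \<phi>01[OF t] ab by (intro curve_length_between[OF g]) auto
      moreover have "\<psi> a = 0" "\<phi> 0 = a" by (auto simp: \<psi>_def \<phi>_def)
      ultimately show ?thesis by (simp add: \<psi> curve_length_refl)
    qed
  qed
  then show "curve_length (subpath a b g) 0 t = curve_length g 0 (a + (b - a) * t) - curve_length g 0 a"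
    by (simp add: p_def \<phi>_def)
qed

lemma
  assumes g: "rectifiable_path g"
  shows rectifiable_path_reversepath: "rectifiable_path (reversepath g)"
    and curve_length_reversepath: "\<And>t. 0 \<le> t \<Longrightarrow> t \<le> 1 \<Longrightarrow>
      curve_length (reversepath g) 0 t = curve_length g 0 1 - curve_length g 0 (1 - t)"
proof -
  define V where "V = curve_length g 0"
  have D: "dist (reversepath g s) (reversepath g t) \<le> - V (1 - t) - - V (1 - s)"
    if "0 \<le> s" "s \<le> t" "t \<le> 1" for s t
    using dist_le_curve_length_diff[OF g, of "1 - t" "1 - s"] that
    by (simp add: reversepath_def V_def dist_commute)
  have "path (reversepath g)"
    using g by (simp add: rectifiable_path_def)
  from rectifiable_pathI[OF this, of "\<lambda>t. - V (1 - t)", OF D]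
  show rp: "rectifiable_path (reversepath g)" by simp
  fix t :: real assume t: "0 \<le> t" "t \<le> 1"
  show "curve_length (reversepath g) 0 t = curve_length g 0 1 - curve_length g 0 (1 - t)"
  proof (rule antisym)
    show "curve_length (reversepath g) 0 t \<le> curve_length g 0 1 - curve_length g 0 (1 - t)"
      using curve_length_le[of 0 t "reversepath g" "\<lambda>t. - V (1 - t)"] D t by (auto simp: V_def)
    \<comment> \<open>The first argument with the roles exchanged: the reflected length function of
      the reversed path dominates the chords of \<open>g\<close>.\<close>
    have "curve_length g (1 - t) 1 \<le>
      - curve_length (reversepath g) 0 (1 - 1) - - curve_length (reversepath g) 0 (1 - (1 - t))"
    proof (rule curve_length_le)
      fix r s assume "1 - t \<le> r" "r \<le> s" "s \<le> 1"
      then show "dist (g r) (g s) \<le>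
        - curve_length (reversepath g) 0 (1 - s) - - curve_length (reversepath g) 0 (1 - r)"
        using dist_le_curve_length_diff[OF rp, of "1 - s" "1 - r"] t
        by (simp add: reversepath_def dist_commute)
    qed (use t in auto)
    then show "curve_length g 0 1 - curve_length g 0 (1 - t) \<le> curve_length (reversepath g) 0 t"
      using curve_length_between[OF g, of "1 - t" 1] t by (simp add: curve_length_refl)
  qed
qed

lemma rectifiable_path_join:
  assumes g: "rectifiable_path g" and h: "rectifiable_path h" and eq: "pathfinish g = pathstart h"
  shows "rectifiable_path (g +++ h)"
proof (rule rectifiable_pathI)
  show "path (g +++ h)"
    using assms by (simp add: rectifiable_path_def)
  define m where "m = (\<lambda>t. if t \<le> 1/2 then curve_length g 0 (2 * t)
    else curve_length g 0 1 + curve_length h 0 (2 * t - 1))"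
  fix s t :: real assume st: "0 \<le> s" "s \<le> t" "t \<le> 1"
  consider "t \<le> 1/2" | "s \<le> 1/2" "1/2 < t" | "1/2 < s" by linarith
  then show "dist ((g +++ h) s) ((g +++ h) t) \<le> m t - m s"
  proof cases
    case 1
    then show ?thesis
      using dist_le_curve_length_diff[OF g, of "2 * s" "2 * t"] st by (simp add: m_def joinpaths_def)
  next
    case 2
    have "dist (g (2 * s)) (h (2 * t - 1)) \<le> dist (g (2 * s)) (g 1) + dist (h 0) (h (2 * t - 1))"
      using eq dist_triangle[of "g (2 * s)" "h (2 * t - 1)" "g 1"] by (simp add: pathstart_def pathfinish_def)
    then show ?thesis
      using dist_le_curve_length_diff[OF g, of "2 * s" 1] dist_le_curve_length_diff[OF h, of 0 "2 * t - 1"] st 2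
      by (simp add: m_def joinpaths_def curve_length_refl)
  next
    case 3
    then show ?thesis
      using dist_le_curve_length_diff[OF h, of "2 * s - 1" "2 * t - 1"] st by (simp add: m_def joinpaths_def)
  qed
qed

section \<open>Line integrals over subpaths, reversed paths and joined paths\<close>

lemma arclength_integral_subpath:
  assumes g: "rectifiable_path g" and ab: "0 \<le> a" "a \<le> b" "b \<le> 1"
  shows "arclength_integral f (subpath a b g) =
    integral {curve_length g 0 a..curve_length g 0 b} (\<lambda>u. f (arclength_param g u))"
proof -
  let ?c = "curve_length g 0 a"
  \<comment> \<open>The arc length parametrization of the subpath is that of \<open>g\<close>,
    shifted by the length \<open>?c\<close> already covered at \<open>a\<close>.\<close>
  have "arclength_integral f (subpath a b g) =
      integral {0..curve_length (subpath a b g) 0 1} (\<lambda>u. f (arclength_param g (u + ?c)))"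
  proof (rule arclength_integral_eqI[OF rectifiable_path_subpath[OF assms]])
    fix t :: real assume t: "0 \<le> t" "t \<le> 1"
    have "(b - a) * t \<le> (b - a) * 1" "0 \<le> (b - a) * t"
      using ab t by (intro mult_left_mono mult_nonneg_nonneg; simp)+
    then have "arclength_param g (curve_length g 0 (a + (b - a) * t)) = g (a + (b - a) * t)"
      using ab by (intro arclength_param_curve_length[OF g]) auto
    then show "arclength_param g (curve_length (subpath a b g) 0 t + ?c) = subpath a b g t"
      unfolding curve_length_subpath[OF assms t] by (simp add: subpath_def add.commute)
  qed
  also have "\<dots> = integral {?c - ?c..curve_length g 0 b - ?c} (\<lambda>u. f (arclength_param g (u + ?c)))"
    by (simp add: curve_length_subpath[OF assms])
  also have "\<dots> = integral {?c..curve_length g 0 b} (\<lambda>u. f (arclength_param g u))"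
    by (rule integral_shift_real_ivl)
  finally show ?thesis .
qed

lemma arclength_integral_reversepath:
  assumes g: "rectifiable_path g"
  shows "arclength_integral f (reversepath g) = arclength_integral f g"
proof -
  let ?L = "curve_length g 0 1"
  let ?h = "\<lambda>u. f (arclength_param g u)"
  have "arclength_integral f (reversepath g) =
      integral {0..curve_length (reversepath g) 0 1} (\<lambda>u. f (arclength_param g (?L - u)))"
  proof (rule arclength_integral_eqI[OF rectifiable_path_reversepath[OF g]])
    fix t :: real assume t: "0 \<le> t" "t \<le> 1"
    show "arclength_param g (?L - curve_length (reversepath g) 0 t) = reversepath g t"
      using arclength_param_curve_length[OF g, of "1 - t"] t
      unfolding curve_length_reversepath[OF g t] by (simp add: reversepath_def)
  qed
  \<comment> \<open>The substitution \<open>?L - u\<close> is split into a shift by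
    \<open>- ?L\<close> and a reflection, which are then removed one after the other.\<close>
  also have "\<dots> = integral {- ?L - - ?L..0 - - ?L} (\<lambda>u. ?h (- (u + - ?L)))"
    by (simp add: curve_length_reversepath[OF g] curve_length_refl)
  also have "\<dots> = integral {- ?L..0} (\<lambda>u. ?h (- u))"
    by (rule integral_shift_real_ivl)
  also have "\<dots> = integral {0..?L} ?h"
    using Henstock_Kurzweil_Integration.integral_reflect_real[of ?L 0 ?h] by simp
  finally show ?thesis
    by (simp add: arclength_integral_def)
qed

lemma arclength_integrand_integrable:
  fixes f :: "'a::metric_space \<Rightarrow> real"
  assumes g: "rectifiable_path g" and f: "continuous_on (path_image g) f"
    and "0 \<le> u" "v \<le> curve_length g 0 1"
  shows "(\<lambda>u. f (arclength_param g u)) integrable_on {u..v}"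
proof (rule integrable_continuous_real)
  have "continuous_on {0..curve_length g 0 1} (\<lambda>u. f (arclength_param g u))"
    by (intro continuous_on_compose2[OF f] continuous_on_arclength_param[OF g])
      (simp add: arclength_param_image[OF g])
  then show "continuous_on {u..v} (\<lambda>u. f (arclength_param g u))"
    by (rule continuous_on_subset) (use assms in auto)
qed

lemma arclength_integral_subpath_combine:
  assumes g: "rectifiable_path g" and f: "continuous_on (path_image g) f"
    and ab: "0 \<le> a" "a \<le> b" "b \<le> c" "c \<le> 1"
  shows "arclength_integral f (subpath a b g) + arclength_integral f (subpath b c g) =
    arclength_integral f (subpath a c g)"
proof -
  have "integral {curve_length g 0 a..curve_length g 0 b} (\<lambda>u. f (arclength_param g u)) +
      integral {curve_length g 0 b..curve_length g 0 c} (\<lambda>u. f (arclength_param g u)) =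
      integral {curve_length g 0 a..curve_length g 0 c} (\<lambda>u. f (arclength_param g u))"
    using curve_length_mono[OF g] curve_length_nonneg[OF g] ab
    by (intro Henstock_Kurzweil_Integration.integral_combine arclength_integrand_integrable[OF g f]) auto
  then show ?thesis
    using assms by (simp add: arclength_integral_subpath[OF g])
qed

text \<open>Both paths are halves of the joined path up to values outside the unit interval, so
  additivity over adjacent subpaths applies.\<close>

lemma arclength_integral_join:
  fixes f :: "'a::real_normed_vector \<Rightarrow> real"
  assumes g: "rectifiable_path g" and h: "rectifiable_path h" and eq: "pathfinish g = pathstart h"
    and f: "continuous_on (path_image g \<union> path_image h) f"
  shows "arclength_integral f (g +++ h) = arclength_integral f g + arclength_integral f h"
proof -
  have r: "rectifiable_path (g +++ h)"
    by (rule rectifiable_path_join[OF g h eq])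
  have f': "continuous_on (path_image (g +++ h)) f"
    using f path_image_join_subset by (rule continuous_on_subset)
  have "arclength_integral f g = arclength_integral f (subpath 0 (1/2) (g +++ h))"
    by (rule arclength_integral_cong[OF _ g]) (simp add: subpath_def joinpaths_def)
  moreover have "arclength_integral f h = arclength_integral f (subpath (1/2) 1 (g +++ h))"
  proof (rule arclength_integral_cong[OF _ h])
    fix t :: real assume "0 \<le> t" "t \<le> 1"
    \<comment> \<open>At \<open>t = 0\<close> the joined path still takes its value from
      \<open>g\<close>; there the common end point \<open>eq\<close> enters.\<close>
    then show "h t = subpath (1/2) 1 (g +++ h) t"
      using eq by (cases "t = 0") (auto simp: subpath_def joinpaths_def pathstart_def pathfinish_def)
  qed
  ultimately show ?thesis
    using arclength_integral_subpath_combine[OF r f', of 0 "1/2" 1] by simp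
qed

section \<open>The quasihyperbolic metric\<close>

locale qh_domain =
  fixes \<Omega> :: "'a::euclidean_space set"
  assumes open_domain: "open \<Omega>" and connected_domain: "connected \<Omega>"
    and domain_nonempty: "\<Omega> \<noteq> {}" and domain_proper: "\<Omega> \<noteq> UNIV"
begin

abbreviation bdist :: "'a \<Rightarrow> real" where
  "bdist z \<equiv> infdist z (frontier \<Omega>)"

lemma frontier_nonempty: "frontier \<Omega> \<noteq> {}"
  using domain_nonempty domain_proper by (simp add: frontier_eq_empty)

lemma bdist_pos: "z \<in> \<Omega> \<Longrightarrow> 0 < bdist z"
  using open_domain frontier_nonempty
  by (intro infdist_pos_not_in_closed) (auto simp: frontier_def interior_open)

lemma bdist_lipschitz: "bdist y \<le> bdist x + dist x y"
  using infdist_triangle[of y "frontier \<Omega>" x] by (simp add: dist_commute)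

text \<open>A ball is connected, so if it met both \<Omega> and the complement it would contain a
  boundary point, which would be closer to \<open>x\<close> than \<open>bdist x\<close>.\<close>

lemma mem_domainI:
  assumes "x \<in> \<Omega>" "dist x y < bdist x"
  shows "y \<in> \<Omega>"
proof (rule ccontr)
  assume "y \<notin> \<Omega>"
  then have "ball x (bdist x) \<inter> frontier \<Omega> \<noteq> {}"
    using assms bdist_pos[OF assms(1)]
    by (intro connected_Int_frontier) (auto intro: exI[of _ x] exI[of _ y] simp: set_eq_iff)
  then obtain z where "z \<in> frontier \<Omega>" "dist x z < bdist x" by auto
  then show False using infdist_le[of z "frontier \<Omega>" x] by simp
qed

lemma continuous_on_density: "continuous_on S (\<lambda>z. 1 / bdist z)" if "S \<subseteq> \<Omega>"
proof -
  have "bdist z \<noteq> 0" if "z \<in> S" for z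
    using bdist_pos[of z] that \<open>S \<subseteq> \<Omega>\<close> by auto
  then show ?thesis by (intro continuous_intros) auto
qed

section \<open>Paths in the domain and bounds for their quasihyperbolic length\<close>

lemma qh_paths_subpath:
  assumes "g \<in> qh_paths \<Omega> x y" "0 \<le> s" "s \<le> t" "t \<le> 1"
  shows "subpath s t g \<in> qh_paths \<Omega> (g s) (g t)"
  using assms rectifiable_path_subpath[of g s t] path_image_subpath_subset[of s t g]
  by (auto simp: qh_paths_def)

lemma qh_paths_reversepath:
  assumes "g \<in> qh_paths \<Omega> x y"
  shows "reversepath g \<in> qh_paths \<Omega> y x"
  using assms rectifiable_path_reversepath[of g] by (auto simp: qh_paths_def)

lemma qh_paths_join:
  assumes "g \<in> qh_paths \<Omega> x y" "h \<in> qh_paths \<Omega> y z"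
  shows "g +++ h \<in> qh_paths \<Omega> x z"
  using assms rectifiable_path_join[of g h] path_image_join_subset[of g h]
  by (auto simp: qh_paths_def)

lemma qh_paths_endpoints:
  assumes "g \<in> qh_paths \<Omega> x y"
  shows "x \<in> \<Omega>" "y \<in> \<Omega>"
  using assms pathstart_in_path_image[of g] pathfinish_in_path_image[of g]
  by (auto simp: qh_paths_def)

lemma qh_paths_mem:
  assumes "g \<in> qh_paths \<Omega> x y" "0 \<le> t" "t \<le> 1"
  shows "g t \<in> \<Omega>"
  using assms by (auto simp: qh_paths_def path_image_def)

lemma qh_length_reversepath:
  "g \<in> qh_paths \<Omega> x y \<Longrightarrow> qh_length \<Omega> (reversepath g) = qh_length \<Omega> g"
  by (simp add: qh_length_def qh_paths_def arclength_integral_reversepath)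

lemma qh_length_join:
  assumes "g \<in> qh_paths \<Omega> x y" "h \<in> qh_paths \<Omega> y z"
  shows "qh_length \<Omega> (g +++ h) = qh_length \<Omega> g + qh_length \<Omega> h"
  unfolding qh_length_def
  using assms by (intro arclength_integral_join continuous_on_density) (auto simp: qh_paths_def)

lemma qh_length_subpath_combine:
  assumes "g \<in> qh_paths \<Omega> x y" "0 \<le> a" "a \<le> b" "b \<le> c" "c \<le> 1"
  shows "qh_length \<Omega> (subpath a b g) + qh_length \<Omega> (subpath b c g) = qh_length \<Omega> (subpath a c g)"
  unfolding qh_length_def
  using assms by (intro arclength_integral_subpath_combine continuous_on_density) (auto simp: qh_paths_def)

lemma qh_length_le:
  assumes g: "g \<in> qh_paths \<Omega> x y" and c: "0 < c" "\<And>z. z \<in> path_image g \<Longrightarrow> c \<le> bdist z"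
  shows "qh_length \<Omega> g \<le> curve_length g 0 1 / c"
proof -
  have r: "rectifiable_path g" and im: "path_image g \<subseteq> \<Omega>"
    using g by (auto simp: qh_paths_def)
  have "qh_length \<Omega> g \<le> integral {0..curve_length g 0 1} (\<lambda>_. 1 / c)"
    unfolding qh_length_def arclength_integral_def
  proof (rule integral_le)
    fix u assume "u \<in> {0..curve_length g 0 1}"
    then have "c \<le> bdist (arclength_param g u)"
      using arclength_param_image[OF r] c by blast
    then show "1 / bdist (arclength_param g u) \<le> 1 / c"
      using c by (intro divide_left_mono) auto
  qed (use arclength_integrand_integrable[OF r continuous_on_density[OF im]] in auto)
  then show ?thesis
    using curve_length_nonneg[OF r, of 1] by simp
qed

lemma qh_length_ge:
  assumes g: "g \<in> qh_paths \<Omega> x y" and c: "\<And>z. z \<in> path_image g \<Longrightarrow> bdist z \<le> c"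
  shows "curve_length g 0 1 / c \<le> qh_length \<Omega> g"
proof -
  have r: "rectifiable_path g" and im: "path_image g \<subseteq> \<Omega>"
    using g by (auto simp: qh_paths_def)
  have "integral {0..curve_length g 0 1} (\<lambda>_. 1 / c) \<le> qh_length \<Omega> g"
    unfolding qh_length_def arclength_integral_def
  proof (rule integral_le)
    fix u assume "u \<in> {0..curve_length g 0 1}"
    then have *: "arclength_param g u \<in> path_image g"
      using arclength_param_image[OF r] by blast
    then have "bdist (arclength_param g u) \<le> c" "0 < bdist (arclength_param g u)"
      using c bdist_pos im by blast+
    then show "1 / c \<le> 1 / bdist (arclength_param g u)"
      by (simp add: frac_le)
  qed (use arclength_integrand_integrable[OF r continuous_on_density[OF im]] in auto)
  then show ?thesis
    using curve_length_nonneg[OF r, of 1] by simp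
qed

lemma dist_le_curve_length:
  assumes "g \<in> qh_paths \<Omega> x y" "z \<in> path_image g"
  shows "dist x z \<le> curve_length g 0 1"
proof -
  have r: "rectifiable_path g" and "x = g 0"
    using assms by (auto simp: qh_paths_def pathstart_def)
  obtain t where t: "0 \<le> t" "t \<le> 1" "z = g t"
    using assms by (auto simp: path_image_def)
  show ?thesis
    using dist_le_curve_length_diff[OF r, of 0 t] curve_length_mono[OF r, of t 1] t \<open>x = g 0\<close>
    by (simp add: curve_length_refl)
qed

text \<open>Along a path of length \<open>?L\<close> the boundary distance is at most
  \<open>bdist x + ?L\<close>, which bounds the density from below. The quotient increases with
  \<open>?L\<close>, and \<open>?L\<close> is at least \<open>dist x y\<close>.\<close>

lemma qh_length_ge_dist:
  assumes g: "g \<in> qh_paths \<Omega> x y"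
  shows "dist x y / (bdist x + dist x y) \<le> qh_length \<Omega> g"
proof -
  let ?L = "curve_length g 0 1"
  have "bdist z \<le> bdist x + ?L" if "z \<in> path_image g" for z
    using dist_le_curve_length[OF g that] bdist_lipschitz[of z x] by simp
  then have "?L / (bdist x + ?L) \<le> qh_length \<Omega> g"
    by (rule qh_length_ge[OF g])
  moreover have "dist x y \<le> ?L"
    using dist_le_curve_length[OF g, of y] g pathfinish_in_path_image[of g] by (auto simp: qh_paths_def)
  then have "dist x y / (bdist x + dist x y) \<le> ?L / (bdist x + ?L)"
    using bdist_pos[OF qh_paths_endpoints(1)[OF g]] zero_le_dist[of x y]
    by (simp add: divide_le_eq pos_le_divide_eq mult.commute field_simps add_pos_nonneg del: zero_le_dist)
  ultimately show ?thesis by linarith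
qed

lemma qh_length_nonneg:
  assumes g: "g \<in> qh_paths \<Omega> x y"
  shows "0 \<le> qh_length \<Omega> g"
proof -
  have "0 \<le> dist x y / (bdist x + dist x y)"
    using bdist_pos[OF qh_paths_endpoints(1)[OF g]] by (intro divide_nonneg_nonneg) auto
  then show ?thesis using qh_length_ge_dist[OF g] by linarith
qed

lemma qh_dist_le_length:
  assumes "g \<in> qh_paths \<Omega> x y"
  shows "qh_dist \<Omega> x y \<le> qh_length \<Omega> g"
  unfolding qh_dist_def using qh_length_nonneg assms
  by (intro cINF_lower) (auto intro!: bdd_belowI[of _ 0])

text \<open>On the segment the boundary distance is at least \<open>bdist x - dist x y\<close>. With
  \<open>qh_length_ge_dist\<close> this shows that at small scales the quasihyperbolic distance is
  the Euclidean one divided by \<open>bdist x\<close>, to first order.\<close>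

lemma linepath_qh_path:
  assumes x: "x \<in> \<Omega>" and xy: "dist x y < bdist x"
  shows "linepath x y \<in> qh_paths \<Omega> x y"
    and "qh_length \<Omega> (linepath x y) \<le> dist x y / (bdist x - dist x y)"
proof -
  have D: "dist (linepath x y s) (linepath x y t) \<le> dist x y * t - dist x y * s" if "s \<le> t" for s t
  proof -
    have "linepath x y s - linepath x y t = (s - t) *\<^sub>R (y - x)"
      by (simp add: linepath_def algebra_simps)
    then have "dist (linepath x y s) (linepath x y t) = \<bar>s - t\<bar> * dist x y"
      by (simp add: dist_norm norm_minus_commute)
    then show ?thesis using that by (simp add: algebra_simps)
  qed
  have r: "rectifiable_path (linepath x y)"
    by (rule rectifiable_pathI[of _ "\<lambda>t. dist x y * t"]) (auto intro: D)
  have L: "curve_length (linepath x y) 0 1 \<le> dist x y"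
    using curve_length_le[of 0 1 "linepath x y" "\<lambda>t. dist x y * t"] D by simp
  have near: "dist x z \<le> dist x y" if "z \<in> path_image (linepath x y)" for z
    using that segment_bound(1)[of z x y] by (simp add: dist_norm norm_minus_commute)
  then have "path_image (linepath x y) \<subseteq> \<Omega>"
    using mem_domainI[OF x] xy by fastforce
  then show *: "linepath x y \<in> qh_paths \<Omega> x y"
    using r by (simp add: qh_paths_def)
  have "bdist x - dist x y \<le> bdist z" if "z \<in> path_image (linepath x y)" for z
    using near[OF that] bdist_lipschitz[of x z] by (simp add: dist_commute)
  then have "qh_length \<Omega> (linepath x y) \<le> curve_length (linepath x y) 0 1 / (bdist x - dist x y)"
    using xy by (intro qh_length_le[OF *]) auto
  also have "\<dots> \<le> dist x y / (bdist x - dist x y)"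
    using L xy by (intro divide_right_mono) auto
  finally show "qh_length \<Omega> (linepath x y) \<le> dist x y / (bdist x - dist x y)" .
qed

text \<open>Being joined by such a path is an equivalence relation whose classes are open, because
  segments join the points of small balls to the centre; connectedness leaves one class. It makes
  the infimum in \<open>qh_dist\<close> one over a nonempty set.\<close>

lemma qh_paths_nonempty:
  assumes "x \<in> \<Omega>" "y \<in> \<Omega>"
  shows "qh_paths \<Omega> x y \<noteq> {}"
proof (rule connected_equivalence_relation[OF connected_domain assms, of "\<lambda>x y. qh_paths \<Omega> x y \<noteq> {}"])
  fix a assume a: "a \<in> \<Omega>"
  show "\<exists>T. openin (top_of_set \<Omega>) T \<and> a \<in> T \<and> (\<forall>x\<in>T. qh_paths \<Omega> a x \<noteq> {})"
  proof (intro exI conjI ballI)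
    show "openin (top_of_set \<Omega>) (\<Omega> \<inter> ball a (bdist a))" by auto
  qed (use a bdist_pos linepath_qh_path(1)[OF a] in auto)
qed (use qh_paths_reversepath qh_paths_join in blast)+

section \<open>The quasihyperbolic distance as a continuous metric\<close>

lemma qh_dist_approx:
  assumes "x \<in> \<Omega>" "y \<in> \<Omega>" "0 < e"
  obtains g where "g \<in> qh_paths \<Omega> x y" "qh_length \<Omega> g < qh_dist \<Omega> x y + e"
proof -
  have "\<exists>g\<in>qh_paths \<Omega> x y. qh_length \<Omega> g < qh_dist \<Omega> x y + e"
  proof (rule ccontr)
    assume "\<not> ?thesis"
    then have "qh_dist \<Omega> x y + e \<le> qh_dist \<Omega> x y"
      unfolding qh_dist_def using qh_paths_nonempty[OF assms(1,2)] by (intro cINF_greatest) force+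
    then show False using assms(3) by simp
  qed
  then show thesis using that by blast
qed

lemma qh_dist_ge:
  assumes "x \<in> \<Omega>" "y \<in> \<Omega>"
  shows "dist x y / (bdist x + dist x y) \<le> qh_dist \<Omega> x y"
  unfolding qh_dist_def using qh_paths_nonempty[OF assms] qh_length_ge_dist by (intro cINF_greatest) auto

lemma qh_dist_le:
  assumes "x \<in> \<Omega>" "dist x y < bdist x"
  shows "qh_dist \<Omega> x y \<le> dist x y / (bdist x - dist x y)"
  using qh_dist_le_length linepath_qh_path[OF assms] by fastforce

text \<open>The lower bound \<open>qh_dist_ge\<close> solved for the Euclidean distance.\<close>

lemma dist_le_qh_dist:
  assumes "x \<in> \<Omega>" "y \<in> \<Omega>" "qh_dist \<Omega> x y \<le> r" "r < 1"
  shows "dist x y \<le> bdist x * (r / (1 - r))"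
proof -
  have "dist x y / (bdist x + dist x y) \<le> r"
    using qh_dist_ge[OF assms(1,2)] assms by linarith
  then have "dist x y \<le> r * (bdist x + dist x y)"
    using bdist_pos[OF assms(1)] by (simp add: pos_divide_le_eq add_pos_nonneg)
  then have "dist x y * (1 - r) \<le> bdist x * r"
    by (simp add: algebra_simps)
  then show ?thesis using assms by (simp add: pos_le_divide_eq)
qed

lemma qh_dist_nonneg: "x \<in> \<Omega> \<Longrightarrow> y \<in> \<Omega> \<Longrightarrow> 0 \<le> qh_dist \<Omega> x y"
  unfolding qh_dist_def using qh_paths_nonempty qh_length_nonneg by (intro cINF_greatest) auto

lemma qh_dist_refl: "x \<in> \<Omega> \<Longrightarrow> qh_dist \<Omega> x x = 0"
  using qh_dist_le[of x x] qh_dist_nonneg[of x x] bdist_pos[of x] by simp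

lemma qh_dist_sym:
  assumes "x \<in> \<Omega>" "y \<in> \<Omega>"
  shows "qh_dist \<Omega> x y = qh_dist \<Omega> y x"
proof -
  have "qh_dist \<Omega> y x \<le> qh_dist \<Omega> x y" if "x \<in> \<Omega>" "y \<in> \<Omega>" for x y
  proof -
    have "qh_dist \<Omega> y x \<le> qh_length \<Omega> g" if "g \<in> qh_paths \<Omega> x y" for g
      using qh_dist_le_length[OF qh_paths_reversepath[OF that]] qh_length_reversepath[OF that] by simp
    then show ?thesis
      unfolding qh_dist_def[of \<Omega> x y] using qh_paths_nonempty[OF that] by (intro cINF_greatest) auto
  qed
  then show ?thesis using assms by (auto intro: antisym)
qed

lemma qh_dist_triangle:
  assumes "x \<in> \<Omega>" "y \<in> \<Omega>" "z \<in> \<Omega>"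
  shows "qh_dist \<Omega> x z \<le> qh_dist \<Omega> x y + qh_dist \<Omega> y z"
proof (rule field_le_epsilon)
  fix e :: real assume "e > 0"
  obtain g where g: "g \<in> qh_paths \<Omega> x y" "qh_length \<Omega> g < qh_dist \<Omega> x y + e / 2"
    using qh_dist_approx[of x y "e / 2"] assms \<open>e > 0\<close> by auto
  obtain h where h: "h \<in> qh_paths \<Omega> y z" "qh_length \<Omega> h < qh_dist \<Omega> y z + e / 2"
    using qh_dist_approx[of y z "e / 2"] assms \<open>e > 0\<close> by auto
  show "qh_dist \<Omega> x z \<le> qh_dist \<Omega> x y + qh_dist \<Omega> y z + e"
    using qh_dist_le_length[OF qh_paths_join[OF g(1) h(1)]] qh_length_join[OF g(1) h(1)] g h by simp
qed

lemma qh_dist_continuous: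
  assumes a: "a \<in> \<Omega>"
  shows "continuous_on \<Omega> (qh_dist \<Omega> a)"
  unfolding continuous_on_iff
proof (intro ballI allI impI)
  fix x and e :: real
  assume x: "x \<in> \<Omega>" and e: "0 < e"
  \<comment> \<open>The solution \<open>d\<close> of \<open>d / (bdist x - d) = e\<close>, the bound
    of \<open>qh_dist_le\<close>.\<close>
  let ?d = "bdist x * (e / (1 + e))"
  show "\<exists>d>0. \<forall>y\<in>\<Omega>. dist y x < d \<longrightarrow> dist (qh_dist \<Omega> a y) (qh_dist \<Omega> a x) < e"
  proof (intro exI conjI ballI impI)
    show "0 < ?d" using bdist_pos[OF x] e by simp
    fix y assume y: "y \<in> \<Omega>" "dist y x < ?d"
    then have *: "dist x y * (1 + e) < bdist x * e"
      using e by (simp add: dist_commute pos_less_divide_eq)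
    have "dist x y * e < bdist x * e"
      using * zero_le_dist[of x y] by (simp only: distrib_left mult_1_right)
    then have lt: "dist x y < bdist x" using e by simp
    have "qh_dist \<Omega> x y \<le> dist x y / (bdist x - dist x y)"
      by (rule qh_dist_le[OF x lt])
    also have "\<dots> < e"
      using * lt by (simp add: pos_divide_less_eq algebra_simps)
    finally show "dist (qh_dist \<Omega> a y) (qh_dist \<Omega> a x) < e"
      using qh_dist_triangle[OF a x y(1)] qh_dist_triangle[OF a y(1) x] qh_dist_sym[OF x y(1)]
      by (simp add: dist_real_def abs_less_iff)
  qed
qed

section \<open>Quasihyperbolic length travelled, as a parameter along a path\<close>

definition clock :: "(real \<Rightarrow> 'a) \<Rightarrow> real \<Rightarrow> real" where
  "clock g t = qh_length \<Omega> (subpath 0 t g)"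

lemma clock_diff:
  assumes "g \<in> qh_paths \<Omega> x y" "0 \<le> s" "s \<le> t" "t \<le> 1"
  shows "clock g t - clock g s = qh_length \<Omega> (subpath s t g)"
  using qh_length_subpath_combine[of g x y 0 s t] assms by (simp add: clock_def)

lemma clock_1 [simp]: "clock g 1 = qh_length \<Omega> g"
  by (simp add: clock_def)

lemma clock_0 [simp]:
  assumes "g \<in> qh_paths \<Omega> x y"
  shows "clock g 0 = 0"
  using clock_diff[OF assms, of 0 0] by (simp add: clock_def)

lemma qh_dist_le_clock:
  assumes g: "g \<in> qh_paths \<Omega> x y" and "0 \<le> s" "s \<le> t" "t \<le> 1"
  shows "qh_dist \<Omega> (g s) (g t) \<le> clock g t - clock g s"
  using qh_dist_le_length[OF qh_paths_subpath[OF assms]] clock_diff[OF assms] by simp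

lemma clock_mono:
  assumes g: "g \<in> qh_paths \<Omega> x y" and "0 \<le> s" "s \<le> t" "t \<le> 1"
  shows "clock g s \<le> clock g t"
  using clock_diff[OF assms] qh_length_nonneg[OF qh_paths_subpath[OF assms]] by simp

lemma qh_dist_le_abs_clock:
  assumes g: "g \<in> qh_paths \<Omega> x y" and "s \<in> {0..1}" "t \<in> {0..1}"
  shows "qh_dist \<Omega> (g s) (g t) \<le> \<bar>clock g t - clock g s\<bar>"
proof (cases "s \<le> t")
  case True
  then show ?thesis using qh_dist_le_clock[OF g, of s t] assms by simp
next
  case False
  then show ?thesis
    using qh_dist_le_clock[OF g, of t s] qh_dist_sym[of "g s" "g t"] qh_paths_mem[OF g] assms by simp
qed

text \<open>The intermediate value theorem applies to the integral of the density in the length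
  variable; \<open>curve_length_attained\<close> then turns the length found into a
  parameter.\<close>

lemma clock_attained:
  assumes g: "g \<in> qh_paths \<Omega> x y" and v: "0 \<le> v" "v \<le> qh_length \<Omega> g"
  obtains t where "t \<in> {0..1}" "clock g t = v"
proof -
  have r: "rectifiable_path g" and im: "path_image g \<subseteq> \<Omega>"
    using g by (auto simp: qh_paths_def)
  let ?V = "curve_length g 0"
  let ?F = "\<lambda>u. integral {0..u} (\<lambda>u. 1 / bdist (arclength_param g u))"
  have clock: "clock g t = ?F (?V t)" if "t \<in> {0..1}" for t
    using arclength_integral_subpath[OF r, of 0 t "\<lambda>z. 1 / bdist z"] that
    by (simp add: clock_def qh_length_def curve_length_refl)
  have "continuous_on {0..?V 1} ?F"
    by (intro indefinite_integral_continuous_1 arclength_integrand_integrable[OF r]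
        continuous_on_density[OF im]) auto
  moreover have "?F 0 \<le> v" "v \<le> ?F (?V 1)"
    using v clock[of 1] by auto
  ultimately obtain u where u: "0 \<le> u" "u \<le> ?V 1" "?F u = v"
    using IVT'[of ?F 0 v "?V 1"] curve_length_nonneg[OF r, of 1] by auto
  obtain t where "0 \<le> t" "t \<le> 1" "?V t = u"
    using curve_length_attained[OF r u(1,2)] by blast
  then show thesis using that[of t] clock[of t] u by simp
qed

end

section \<open>Midpoints of quasihyperbolic balls\<close>

text \<open>The parallelogram law for \<open>x - p\<close> and \<open>y - p\<close>.\<close>

lemma dist_midpoint_square:
  fixes x y p :: "'a::real_inner"
  shows "(dist (midpoint x y) p)\<^sup>2 = ((dist x p)\<^sup>2 + (dist y p)\<^sup>2) / 2 - (dist x y)\<^sup>2 / 4"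
proof -
  define u v where "u = x - p" and "v = y - p"
  have "midpoint x y - p = (1/2) *\<^sub>R (u + v)"
    by (simp add: midpoint_def u_def v_def algebra_simps flip: scaleR_add_left)
  moreover have "x - y = u - v" by (simp add: u_def v_def)
  moreover have "(norm ((1/2) *\<^sub>R (u + v)))\<^sup>2 = ((norm u)\<^sup>2 + (norm v)\<^sup>2) / 2 - (norm (u - v))\<^sup>2 / 4"
    by (simp add: power2_norm_eq_inner power_mult_distrib inner_add inner_diff inner_commute field_simps)
  ultimately show ?thesis
    by (simp add: dist_norm u_def v_def)
qed

text \<open>The discrete Poincare inequality: telescoping from \<open>w 0 = 0\<close>, then
  Cauchy-Schwarz.\<close>

lemma sum_steps_le:
  fixes w :: "nat \<Rightarrow> 'a::real_normed_vector"
  assumes "w 0 = 0" "i \<le> N"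
  shows "(norm (w i))\<^sup>2 \<le> real N * (\<Sum>j<N. (norm (w (Suc j) - w j))\<^sup>2)"
proof -
  have "w i = (\<Sum>j<i. w (Suc j) - w j)"
    by (simp add: sum_lessThan_telescope assms(1))
  then have "norm (w i) \<le> (\<Sum>j<i. norm (w (Suc j) - w j))"
    by (metis norm_sum)
  then have "(norm (w i))\<^sup>2 \<le> (\<Sum>j<i. norm (w (Suc j) - w j))\<^sup>2"
    by (simp add: power_mono)
  also have "\<dots> \<le> (\<Sum>j<i. (norm (w (Suc j) - w j))\<^sup>2) * real i"
    using sum_squared_le_sum_of_squares[of "\<lambda>j. norm (w (Suc j) - w j)" "{..<i}"] by simp
  also have "\<dots> \<le> (\<Sum>j<N. (norm (w (Suc j) - w j))\<^sup>2) * real N"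
    using assms by (intro mult_mono sum_mono2 sum_nonneg) auto
  finally show ?thesis by (simp add: mult.commute)
qed

context qh_domain
begin

text \<open>The square of the boundary distance is, up to a square of the norm, an infimum of
  affine functions.\<close>

lemma bdist_midpoint:
  "((bdist x)\<^sup>2 + (bdist y)\<^sup>2) / 2 - (dist x y)\<^sup>2 / 4 \<le> (bdist (midpoint x y))\<^sup>2"
proof -
  \<comment> \<open>For a boundary point nearest to the midpoint the midpoint identity is exact on
    the right, while on the left its distances bound \<open>bdist\<close> from above.\<close>
  obtain p where p: "p \<in> frontier \<Omega>" "bdist (midpoint x y) = dist (midpoint x y) p"
    using infdist_attains_inf[OF frontier_closed frontier_nonempty] by metis
  have "(bdist z)\<^sup>2 \<le> (dist z p)\<^sup>2" for z
    using infdist_le[OF p(1)] infdist_nonneg by (intro power_mono)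
  from this[of x] this[of y] show ?thesis
    unfolding p(2) dist_midpoint_square by simp
qed

text \<open>The parallelogram law for the two steps, with \<open>bdist_midpoint\<close> replacing
  the mean of the squared boundary distances. The subtracted term is the gain; the term with
  \<open>x - y\<close> is the loss from comparing with the midpoint.\<close>

lemma midpoint_step:
  assumes "dist x x' \<le> bdist x * s" "dist y y' \<le> bdist y * s"
  shows "(dist (midpoint x y) (midpoint x' y'))\<^sup>2 \<le>
    s\<^sup>2 * (bdist (midpoint x y))\<^sup>2 + s\<^sup>2 * (norm (x - y))\<^sup>2 / 4 - (norm ((x' - y') - (x - y)))\<^sup>2 / 4"
proof -
  define u v where "u = x' - x" and "v = y' - y"
  have "midpoint x y - midpoint x' y' = - (1/2) *\<^sub>R (u + v)"
    by (simp add: midpoint_def u_def v_def algebra_simps)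
  then have "(dist (midpoint x y) (midpoint x' y'))\<^sup>2 = (norm (u + v))\<^sup>2 / 4"
    by (simp add: dist_norm power_mult_distrib power_divide)
  also have "\<dots> = ((norm u)\<^sup>2 + (norm v)\<^sup>2) / 2 - (norm (u - v))\<^sup>2 / 4"
    by (simp add: power2_norm_eq_inner inner_add inner_diff inner_commute field_simps)
  also have "\<dots> \<le> ((bdist x * s)\<^sup>2 + (bdist y * s)\<^sup>2) / 2 - (norm (u - v))\<^sup>2 / 4"
    using power_mono[OF assms(1), of 2] power_mono[OF assms(2), of 2]
    by (simp add: u_def v_def dist_norm norm_minus_commute)
  also have "\<dots> \<le> s\<^sup>2 * ((bdist (midpoint x y))\<^sup>2 + (dist x y)\<^sup>2 / 4) - (norm (u - v))\<^sup>2 / 4"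
    using mult_left_mono[OF bdist_midpoint[of x y], of "s\<^sup>2"]
    by (simp add: power_mult_distrib algebra_simps)
  also have "u - v = (x' - y') - (x - y)"
    by (simp add: u_def v_def)
  finally show ?thesis
    by (simp add: dist_norm algebra_simps)
qed

section \<open>Chains of points and the chain of their midpoints\<close>

lemma qh_chain:
  assumes "x \<in> \<Omega>" "y \<in> \<Omega>" "qh_dist \<Omega> x y < k" "0 < N"
  obtains z :: "nat \<Rightarrow> 'a" where "z 0 = x" "z N = y" "\<And>i. i \<le> N \<Longrightarrow> z i \<in> \<Omega>"
    "\<And>i. i \<le> N \<Longrightarrow> qh_dist \<Omega> x (z i) \<le> k"
    "\<And>i. i < N \<Longrightarrow> qh_dist \<Omega> (z i) (z (Suc i)) \<le> k / real N"
proof -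
  \<comment> \<open>A path of length below \<open>k\<close> is cut at equally spaced values of
    \<open>clock\<close>.\<close>
  obtain g where g: "g \<in> qh_paths \<Omega> x y" and len: "qh_length \<Omega> g < k"
    using qh_dist_approx[of x y "k - qh_dist \<Omega> x y"] assms by auto
  let ?l = "qh_length \<Omega> g"
  have l: "0 \<le> ?l" using qh_length_nonneg[OF g] .
  have g01: "g 0 = x" "g 1 = y"
    using g by (auto simp: qh_paths_def pathstart_def pathfinish_def)
  \<comment> \<open>The first and last parameters are prescribed so that the chain starts at
    \<open>x\<close> and stops at \<open>y\<close>.\<close>
  have "\<exists>t. t \<in> {0..1} \<and> clock g t = real i / real N * ?l \<and> (i = 0 \<longrightarrow> t = 0) \<and> (i = N \<longrightarrow> t = 1)"
    if "i \<le> N" for i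
  proof -
    consider "i = 0" | "i = N" | "i \<noteq> 0" "i \<noteq> N" by blast
    then show ?thesis
    proof cases
      case 1
      then show ?thesis using g assms(4) by (intro exI[of _ 0]) auto
    next
      case 2
      then show ?thesis using assms(4) by (intro exI[of _ 1]) auto
    next
      case 3
      have "real i / real N * ?l \<le> 1 * ?l"
        using that l assms(4) by (intro mult_right_mono) auto
      then show ?thesis
        using clock_attained[OF g, of "real i / real N * ?l"] l 3 by (metis divide_nonneg_nonneg
            mult_1 mult_nonneg_nonneg of_nat_0_le_iff)
    qed
  qed
  then obtain t where t: "\<And>i. i \<le> N \<Longrightarrow> t i \<in> {0..1}"
      "\<And>i. i \<le> N \<Longrightarrow> clock g (t i) = real i / real N * ?l" "t 0 = 0" "t N = 1"
    by (metis le0 le_refl)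
  show thesis
  proof (rule that[of "\<lambda>i. g (t i)"])
    show "g (t 0) = x" "g (t N) = y" using t g01 by auto
    show "g (t i) \<in> \<Omega>" if "i \<le> N" for i
      using qh_paths_mem[OF g] t(1)[OF that] by auto
    show "qh_dist \<Omega> x (g (t i)) \<le> k" if "i \<le> N" for i
      using qh_dist_le_clock[OF g, of 0 "t i"] clock_mono[OF g, of "t i" 1] t(1)[OF that] len g01 g
      by simp
    show "qh_dist \<Omega> (g (t i)) (g (t (Suc i))) \<le> k / real N" if "i < N" for i
    proof -
      have "qh_dist \<Omega> (g (t i)) (g (t (Suc i))) \<le> \<bar>clock g (t (Suc i)) - clock g (t i)\<bar>"
        using that by (intro qh_dist_le_abs_clock[OF g] t) auto
      also have "clock g (t (Suc i)) - clock g (t i) = ?l / real N"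
        using that assms(4) by (simp add: t field_simps)
      also have "\<bar>?l / real N\<bar> \<le> k / real N"
        using l len by (simp add: divide_right_mono)
      finally show ?thesis .
    qed
  qed
qed

lemma qh_dist_chain:
  assumes "\<And>i. i \<le> N \<Longrightarrow> z i \<in> \<Omega>"
  shows "qh_dist \<Omega> (z 0) (z N) \<le> (\<Sum>i<N. qh_dist \<Omega> (z i) (z (Suc i)))"
  using assms
proof (induction N)
  case 0
  then show ?case by (simp add: qh_dist_refl)
next
  case (Suc N)
  then show ?case
    using qh_dist_triangle[of "z 0" "z N" "z (Suc N)"] by force
qed

lemma near_bounds:
  assumes a: "a \<in> \<Omega>" and z: "dist a z \<le> bdist a / 8"
  shows "z \<in> \<Omega>" "7/8 * bdist a \<le> bdist z" "bdist z \<le> 9/8 * bdist a"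
  using mem_domainI[OF a, of z] bdist_pos[OF a] bdist_lipschitz[of z a] bdist_lipschitz[of a z] z
  by (auto simp: dist_commute)

text \<open>For \<open>r = 1/9\<close> the factor \<open>r / (1 - r)\<close> is \<open>1/8\<close>,
  the radius in \<open>near_bounds\<close>.\<close>

lemma dist_near:
  assumes "a \<in> \<Omega>" "z \<in> \<Omega>" "qh_dist \<Omega> a z \<le> 1/9"
  shows "dist a z \<le> bdist a / 8"
  using dist_le_qh_dist[OF assms] by simp

lemma dist_midpoint_le:
  fixes a x y :: 'a
  assumes "dist a x \<le> r" "dist a y \<le> r"
  shows "dist a (midpoint x y) \<le> r"
  using convex_cball[of a r] assms midpoint_in_closed_segment[of x y]
  by (meson closed_segment_subset mem_cball subsetD)

text \<open>The comparison for a fixed number of steps. By \<open>dist_le_qh_dist\<close>,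
  \<open>s\<close> bounds a Euclidean step relative to the boundary distance; the factor
  \<open>1 - 2 * s\<close> pays for returning from Euclidean to quasihyperbolic steps.\<close>

lemma midpoint_chain:
  assumes a: "a \<in> \<Omega>" and pq: "p \<in> \<Omega>" "q \<in> \<Omega>"
    and k: "qh_dist \<Omega> a p < k" "qh_dist \<Omega> a q < k" "k \<le> 1/9" and N: "0 < N"
    and s: "s = (k / real N) / (1 - k / real N)"
  shows "(qh_dist \<Omega> a (midpoint p q) * (1 - 2 * s))\<^sup>2 \<le>
    (real N * s)\<^sup>2 - (dist p q)\<^sup>2 / (16 * (bdist a)\<^sup>2)"
proof -
  define \<rho> where "\<rho> = bdist a"
  have \<rho>: "0 < \<rho>" using bdist_pos[OF a] by (simp add: \<rho>_def)
  have k0: "0 < k" using qh_dist_nonneg[OF a pq(1)] k by simp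
  have kN: "k / real N \<le> k"
    using k0 N by (simp add: divide_le_eq)
  then have kN': "0 < k / real N" "k / real N \<le> 1/9" "1 - k / real N \<ge> 8/9" using k k0 N by auto
  have s0: "0 < s" unfolding s by (rule divide_pos_pos) (use kN' in linarith)+
  have Ns: "real N * s \<le> 1/8"
  proof -
    have "real N * s = k / (1 - k / real N)" using N by (simp add: s)
    also have "\<dots> \<le> (1/9) / (8/9)" using kN' k k0 by (intro frac_le) auto
    finally show ?thesis by simp
  qed
  have s1: "s \<le> 1/8"
  proof -
    have "1 * s \<le> real N * s" using s0 N by (intro mult_right_mono) auto
    then show ?thesis using Ns by simp
  qed
  obtain x where x: "x 0 = a" "x N = p" "\<And>i. i \<le> N \<Longrightarrow> x i \<in> \<Omega>"
    "\<And>i. i \<le> N \<Longrightarrow> qh_dist \<Omega> a (x i) \<le> k"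
    "\<And>i. i < N \<Longrightarrow> qh_dist \<Omega> (x i) (x (Suc i)) \<le> k / real N"
    using qh_chain[OF a pq(1) k(1) N] by metis
  obtain y where y: "y 0 = a" "y N = q" "\<And>i. i \<le> N \<Longrightarrow> y i \<in> \<Omega>"
    "\<And>i. i \<le> N \<Longrightarrow> qh_dist \<Omega> a (y i) \<le> k"
    "\<And>i. i < N \<Longrightarrow> qh_dist \<Omega> (y i) (y (Suc i)) \<le> k / real N"
    using qh_chain[OF a pq(2) k(2) N] by metis
  define m where "m i = midpoint (x i) (y i)" for i
  define w where "w i = x i - y i" for i
  define b where "b i = bdist (m i)" for i
  define e where "e i = dist (m i) (m (Suc i))" for i
  define T where "T = (\<Sum>i<N. (norm (w (Suc i) - w i))\<^sup>2)"
  have T0: "0 \<le> T" by (simp add: T_def sum_nonneg)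
  have near: "dist a (x i) \<le> \<rho> / 8" "dist a (y i) \<le> \<rho> / 8" "dist a (m i) \<le> \<rho> / 8" if "i \<le> N" for i
  proof -
    show 1: "dist a (x i) \<le> \<rho> / 8" "dist a (y i) \<le> \<rho> / 8"
      unfolding \<rho>_def using x(3,4)[OF that] y(3,4)[OF that] k(3)
      by (meson a dist_near order_trans)+
    show "dist a (m i) \<le> \<rho> / 8"
      unfolding m_def by (rule dist_midpoint_le[OF 1])
  qed
  note bounds = near_bounds[OF a, folded \<rho>_def]
  have m\<Omega>: "m i \<in> \<Omega>" and b: "7/8 * \<rho> \<le> b i" "b i \<le> 9/8 * \<rho>" "0 < b i" if "i \<le> N" for i
    using bounds[OF near(3)[OF that]] \<rho> by (auto simp: b_def)
  have step: "dist (x i) (x (Suc i)) \<le> bdist (x i) * s" "dist (y i) (y (Suc i)) \<le> bdist (y i) * s"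
    if "i < N" for i
    unfolding s using x(3)[of i] x(3)[of "Suc i"] x(5)[of i] y(3)[of i] y(3)[of "Suc i"] y(5)[of i] that kN'
    by (intro dist_le_qh_dist; linarith)+
  have e2: "(e i)\<^sup>2 \<le> s\<^sup>2 * (b i)\<^sup>2 + s\<^sup>2 * (norm (w i))\<^sup>2 / 4 - (norm (w (Suc i) - w i))\<^sup>2 / 4"
    if "i < N" for i
    unfolding e_def b_def m_def w_def by (rule midpoint_step[OF step[OF that]])
  \<comment> \<open>Boundary distances at all chain points are between \<open>7/8 * \<rho>\<close>
    and \<open>9/8 * \<rho>\<close>, hence within a factor 2 of each other.\<close>
  have e_small: "e i \<le> 2 * s * b i" if "i < N" for i
  proof -
    have "m i - m (Suc i) = (1/2) *\<^sub>R ((x i - x (Suc i)) + (y i - y (Suc i)))"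
      by (simp add: m_def midpoint_def algebra_simps)
    then have "e i \<le> (dist (x i) (x (Suc i)) + dist (y i) (y (Suc i))) / 2"
      using norm_triangle_ineq[of "x i - x (Suc i)" "y i - y (Suc i)"] by (simp add: e_def dist_norm)
    also have "\<dots> \<le> (bdist (x i) + bdist (y i)) / 2 * s"
      using step[OF that] by (simp add: algebra_simps)
    also have "\<dots> \<le> (2 * b i) * s"
      using bounds(3)[OF near(1), of i] bounds(3)[OF near(2), of i] b(1)[of i] that \<rho> s0
      by (intro mult_right_mono) auto
    finally show ?thesis by (simp add: mult_ac)
  qed
  \<comment> \<open>\<open>e_small\<close> bounds the denominator \<open>b i - e i\<close> of
    \<open>qh_dist_le\<close> below by \<open>b i * (1 - 2 * s)\<close>.\<close>
  have dm: "qh_dist \<Omega> (m i) (m (Suc i)) * (1 - 2 * s) \<le> e i / b i" if "i < N" for i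
  proof -
    have b0: "0 < b i" using b(3) that by simp
    have "2 * s * b i < 1 * b i" using s1 b0 by (intro mult_strict_right_mono) auto
    then have lt: "e i < b i" using e_small[OF that] by simp
    have "qh_dist \<Omega> (m i) (m (Suc i)) \<le> e i / (b i - e i)"
      unfolding e_def b_def using lt that by (intro qh_dist_le m\<Omega>) (auto simp: e_def b_def)
    also have "\<dots> \<le> e i / (b i * (1 - 2 * s))"
      using e_small[OF that] s1 b0 by (intro divide_left_mono mult_pos_pos) (auto simp: e_def algebra_simps lt[unfolded e_def])
    finally show ?thesis
      using s1 b0 by (simp add: field_simps)
  qed
  \<comment> \<open>Divide \<open>e2\<close> by \<open>(b i)\<^sup>2\<close>, which is between
    \<open>\<rho>\<^sup>2 / 2\<close> and \<open>2 * \<rho>\<^sup>2\<close>: the lower bound and the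
    Poincare inequality serve the loss, the upper bound the gain.\<close>
  have q2: "(e i / b i)\<^sup>2 \<le> s\<^sup>2 + s\<^sup>2 * (real N * T) / (2 * \<rho>\<^sup>2) - (norm (w (Suc i) - w i))\<^sup>2 / (8 * \<rho>\<^sup>2)"
    if "i < N" for i
  proof -
    have b0: "0 < b i" using b(3) that by simp
    have "(7/8 * \<rho>)\<^sup>2 \<le> (b i)\<^sup>2" "(b i)\<^sup>2 \<le> (9/8 * \<rho>)\<^sup>2"
      using b[of i] that \<rho> by (auto intro!: power_mono)
    then have b2: "\<rho>\<^sup>2 / 2 \<le> (b i)\<^sup>2" "(b i)\<^sup>2 \<le> 2 * \<rho>\<^sup>2"
      using zero_le_power2[of \<rho>] by (auto simp: power_mult_distrib power_divide)
    have w: "(norm (w i))\<^sup>2 \<le> real N * T"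
      unfolding T_def using that by (intro sum_steps_le) (auto simp: w_def x y)
    have "(e i / b i)\<^sup>2 \<le> (s\<^sup>2 * (b i)\<^sup>2 + s\<^sup>2 * (norm (w i))\<^sup>2 / 4 - (norm (w (Suc i) - w i))\<^sup>2 / 4) / (b i)\<^sup>2"
      unfolding power_divide using e2[OF that] by (intro divide_right_mono) auto
    also have "\<dots> = s\<^sup>2 + s\<^sup>2 * (norm (w i))\<^sup>2 / (4 * (b i)\<^sup>2) - (norm (w (Suc i) - w i))\<^sup>2 / (4 * (b i)\<^sup>2)"
      using b0 by (simp add: field_simps)
    also have "\<dots> \<le> s\<^sup>2 + s\<^sup>2 * (real N * T) / (2 * \<rho>\<^sup>2) - (norm (w (Suc i) - w i))\<^sup>2 / (8 * \<rho>\<^sup>2)"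
      using b2 b0 \<rho> w T0 by (intro diff_mono add_left_mono frac_le mult_left_mono) auto
    finally show ?thesis .
  qed
  have m_ends: "m 0 = a" "m N = midpoint p q" by (simp_all add: m_def x y)
  then have "qh_dist \<Omega> a (midpoint p q) * (1 - 2 * s) \<le> (\<Sum>i<N. qh_dist \<Omega> (m i) (m (Suc i))) * (1 - 2 * s)"
    using qh_dist_chain[of N m] m\<Omega> s1 by (intro mult_right_mono) auto
  also have "\<dots> \<le> (\<Sum>i<N. e i / b i)"
    unfolding sum_distrib_right by (intro sum_mono dm) auto
  finally have "(qh_dist \<Omega> a (midpoint p q) * (1 - 2 * s))\<^sup>2 \<le> (\<Sum>i<N. e i / b i)\<^sup>2"
    using qh_dist_nonneg[OF a m\<Omega>[of N]] s1 m_ends by (intro power_mono mult_nonneg_nonneg) auto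
  also have "\<dots> \<le> (\<Sum>i<N. (e i / b i)\<^sup>2) * real N"
    using sum_squared_le_sum_of_squares[of "\<lambda>i. e i / b i" "{..<N}"] by simp
  also have "\<dots> \<le> (\<Sum>i<N. s\<^sup>2 + s\<^sup>2 * (real N * T) / (2 * \<rho>\<^sup>2) - (norm (w (Suc i) - w i))\<^sup>2 / (8 * \<rho>\<^sup>2)) * real N"
    by (intro mult_right_mono sum_mono q2) auto
  also have "\<dots> = (real N * (s\<^sup>2 + s\<^sup>2 * (real N * T) / (2 * \<rho>\<^sup>2)) - T / (8 * \<rho>\<^sup>2)) * real N"
    by (simp add: sum_subtractf T_def sum_divide_distrib)
  also have "\<dots> = (real N * s)\<^sup>2 + (real N * T) / \<rho>\<^sup>2 * ((real N * s)\<^sup>2 / 2 - 1 / 8)"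
    using \<rho> by (simp add: field_simps power2_eq_square)
  \<comment> \<open>Gain beats loss: \<open>real N * s \<le> 1/8\<close> makes the coefficient at
    most \<open>1/128 - 1/8\<close>, which is below \<open>- 1/16\<close>.\<close>
  also have "\<dots> \<le> (real N * s)\<^sup>2 + (real N * T) / \<rho>\<^sup>2 * (- 1 / 16)"
  proof -
    have "(real N * s)\<^sup>2 \<le> (1/8)\<^sup>2" using Ns s0 by (intro power_mono) auto
    then have "(real N * s)\<^sup>2 / 2 - 1 / 8 \<le> - 1 / 16" by (simp add: power2_eq_square)
    then show ?thesis using T0 by (intro add_left_mono mult_left_mono) auto
  qed
  \<comment> \<open>The Poincare inequality once more, now at \<open>i = N\<close>, where
    \<open>w N = p - q\<close>.\<close>
  also have "\<dots> \<le> (real N * s)\<^sup>2 - (dist p q)\<^sup>2 / (16 * \<rho>\<^sup>2)"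
  proof -
    have "(norm (w N))\<^sup>2 \<le> real N * T"
      unfolding T_def by (intro sum_steps_le) (auto simp: w_def x y)
    then have "(dist p q)\<^sup>2 / (16 * \<rho>\<^sup>2) \<le> (real N * T) / (16 * \<rho>\<^sup>2)"
      by (intro divide_right_mono) (auto simp: w_def x y dist_norm)
    then show ?thesis by simp
  qed
  finally show ?thesis by (simp add: \<rho>_def)
qed

text \<open>Limit of \<open>midpoint_chain\<close> with \<open>n\<close> steps and
  \<open>k n = M + 1 / n\<close>: then \<open>s\<close> tends to 0 and \<open>n * s\<close> to
  \<open>M\<close>. The added \<open>1 / n\<close> supplies the strict inequalities required
  there.\<close>

lemma qh_dist_midpoint_square:
  assumes a: "a \<in> \<Omega>" and pq: "p \<in> \<Omega>" "q \<in> \<Omega>"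
    and M: "qh_dist \<Omega> a p \<le> M" "qh_dist \<Omega> a q \<le> M" "M \<le> 1/10"
  shows "(qh_dist \<Omega> a (midpoint p q))\<^sup>2 \<le> M\<^sup>2 - (dist p q)\<^sup>2 / (16 * (bdist a)\<^sup>2)"
proof -
  let ?d = "qh_dist \<Omega> a (midpoint p q)"
  define X where "X n = 1 / real n" for n :: nat
  define k where "k n = M + X n" for n
  define h where "h n = k n * X n" for n
  have X: "X \<longlonglongrightarrow> 0" unfolding X_def by (rule lim_const_over_n)
  have kl: "k \<longlonglongrightarrow> M" unfolding k_def using tendsto_add[OF tendsto_const X, of M] by simp
  have hl: "h \<longlonglongrightarrow> 0" unfolding h_def using tendsto_mult[OF kl X] by simp
  have "(\<lambda>n. (?d * (1 - 2 * (h n / (1 - h n))))\<^sup>2) \<longlonglongrightarrow> (?d * (1 - 2 * (0 / (1 - 0))))\<^sup>2"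
    by (intro tendsto_intros hl) simp
  moreover have "(\<lambda>n. (k n / (1 - h n))\<^sup>2 - (dist p q)\<^sup>2 / (16 * (bdist a)\<^sup>2))
      \<longlonglongrightarrow> (M / (1 - 0))\<^sup>2 - (dist p q)\<^sup>2 / (16 * (bdist a)\<^sup>2)"
    by (intro tendsto_intros kl hl) simp
  \<comment> \<open>From \<open>n = 90\<close> on, \<open>k n\<close> is at most
    \<open>1/10 + 1/90 = 1/9\<close>.\<close>
  moreover have "\<exists>n0. \<forall>n\<ge>n0. (?d * (1 - 2 * (h n / (1 - h n))))\<^sup>2 \<le>
      (k n / (1 - h n))\<^sup>2 - (dist p q)\<^sup>2 / (16 * (bdist a)\<^sup>2)"
  proof (intro exI[of _ 90] allI impI)
    fix n :: nat assume n: "90 \<le> n"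
    have X: "0 < X n" "X n \<le> 1/90" using n by (auto simp: X_def field_simps)
    have "(?d * (1 - 2 * (h n / (1 - h n))))\<^sup>2 \<le>
      (real n * (h n / (1 - h n)))\<^sup>2 - (dist p q)\<^sup>2 / (16 * (bdist a)\<^sup>2)"
    proof (rule midpoint_chain[OF a pq])
      show "qh_dist \<Omega> a p < k n" "qh_dist \<Omega> a q < k n" "k n \<le> 1/9"
        unfolding k_def using M X by linarith+
      show "h n / (1 - h n) = k n / real n / (1 - k n / real n)"
        by (simp add: h_def X_def)
    qed (use n in simp)
    also have "real n * (h n / (1 - h n)) = k n / (1 - h n)"
      using n by (simp add: h_def X_def)
    finally show "(?d * (1 - 2 * (h n / (1 - h n))))\<^sup>2 \<le>
      (k n / (1 - h n))\<^sup>2 - (dist p q)\<^sup>2 / (16 * (bdist a)\<^sup>2)" .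
  qed
  ultimately have "(?d * (1 - 2 * (0 / (1 - 0))))\<^sup>2 \<le> (M / (1 - 0))\<^sup>2 - (dist p q)\<^sup>2 / (16 * (bdist a)\<^sup>2)"
    by (rule LIMSEQ_le)
  then show ?thesis by simp
qed

lemma midpoint_mem_domain:
  assumes a: "a \<in> \<Omega>" and "p \<in> \<Omega>" "q \<in> \<Omega>" "qh_dist \<Omega> a p \<le> 1/10" "qh_dist \<Omega> a q \<le> 1/10"
  shows "midpoint p q \<in> \<Omega>"
proof (rule near_bounds(1)[OF a], rule dist_midpoint_le)
  show "dist a p \<le> bdist a / 8" "dist a q \<le> bdist a / 8"
    by (rule dist_near[OF a]; use assms in linarith)+
qed

lemma qh_dist_midpoint_less:
  assumes a: "a \<in> \<Omega>" and pq: "p \<in> \<Omega>" "q \<in> \<Omega>" "p \<noteq> q"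
    and M: "qh_dist \<Omega> a p \<le> M" "qh_dist \<Omega> a q \<le> M" "M \<le> 1/10"
  shows "qh_dist \<Omega> a (midpoint p q) < M"
proof -
  have "0 < (dist p q)\<^sup>2 / (16 * (bdist a)\<^sup>2)"
    using pq bdist_pos[OF a] by simp
  then have "(qh_dist \<Omega> a (midpoint p q))\<^sup>2 < M\<^sup>2"
    using qh_dist_midpoint_square[OF a pq(1,2) M] by linarith
  moreover have "0 \<le> M" using qh_dist_nonneg[OF a pq(1)] M by linarith
  ultimately show ?thesis by (rule power2_less_imp_less)
qed

end

context qh_domain
begin

section \<open>Strict convexity of small balls\<close>

lemma open_qh_ball:
  assumes "a \<in> \<Omega>"
  shows "open (qh_ball \<Omega> a r)"
proof -
  have "qh_ball \<Omega> a r = qh_dist \<Omega> a -` {..<r} \<inter> \<Omega>"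
    by (auto simp: qh_ball_def)
  then show ?thesis
    using continuous_on_open_vimage[OF open_domain, THEN iffD1, rule_format,
        OF qh_dist_continuous[OF assms] open_lessThan] by metis
qed

lemma qh_dist_limit_le:
  assumes a: "a \<in> \<Omega>" and z: "\<And>n. z n \<in> \<Omega>" "z \<longlonglongrightarrow> l" "l \<in> \<Omega>"
    and c: "\<And>n. qh_dist \<Omega> a (z n) \<le> c n" "c \<longlonglongrightarrow> C"
  shows "qh_dist \<Omega> a l \<le> C"
proof -
  have "(\<lambda>n. qh_dist \<Omega> a (z n)) \<longlonglongrightarrow> qh_dist \<Omega> a l"
    using z by (intro continuous_on_tendsto_compose[OF qh_dist_continuous[OF a]]) auto
  then show ?thesis
    using c by (intro LIMSEQ_le) auto
qed

text \<open>The ball lies in a closed Euclidean ball contained in \<Omega>, so its limit points do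
  not leave \<Omega>, and continuity carries the bound over.\<close>

lemma closure_qh_ball:
  assumes a: "a \<in> \<Omega>" and r: "r \<le> 1/9" and z: "z \<in> closure (qh_ball \<Omega> a r)"
  shows "z \<in> \<Omega>" "qh_dist \<Omega> a z \<le> r"
proof -
  have "dist a y \<le> bdist a / 8" if "y \<in> qh_ball \<Omega> a r" for y
    by (rule dist_near[OF a]) (use that r in \<open>auto simp: qh_ball_def\<close>)
  then have "closure (qh_ball \<Omega> a r) \<subseteq> cball a (bdist a / 8)"
    by (intro closure_minimal) auto
  then show z\<Omega>: "z \<in> \<Omega>"
    using z by (intro near_bounds(1)[OF a]) auto
  obtain x where x: "\<And>n. x n \<in> qh_ball \<Omega> a r" "x \<longlonglongrightarrow> z"
    using z unfolding closure_sequential by blast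
  show "qh_dist \<Omega> a z \<le> r"
  proof (rule qh_dist_limit_le[OF a _ x(2) z\<Omega> _ tendsto_const])
    show "x n \<in> \<Omega>" "qh_dist \<Omega> a (x n) \<le> r" for n
      using x(1)[of n] by (auto simp: qh_ball_def)
  qed
qed

text \<open>Along a segment the distance to \<open>a\<close> has no interior maximum, since such a maximum
  would be the midpoint of a shorter segment.\<close>

lemma strictly_convex_qh_ball:
  assumes a: "a \<in> \<Omega>" and r: "r < 1/100"
  shows "strictly_convex (qh_ball \<Omega> a r)"
  unfolding strictly_convex_def
proof (intro ballI impI subsetI)
  fix p q z
  assume pq: "p \<in> closure (qh_ball \<Omega> a r)" "q \<in> closure (qh_ball \<Omega> a r)" "p \<noteq> q"
    and z: "z \<in> open_segment p q"
  define c where "c t = p + t *\<^sub>R (q - p)" for t :: real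
  have ends: "c 0 = p" "c 1 = q" by (simp_all add: c_def)
  have in\<Omega>: "p \<in> \<Omega>" "q \<in> \<Omega>" and dr: "qh_dist \<Omega> a p \<le> r" "qh_dist \<Omega> a q \<le> r"
    using closure_qh_ball[OF a _ pq(1)] closure_qh_ball[OF a _ pq(2)] r by auto
  have near: "dist a p \<le> bdist a / 99" "dist a q \<le> bdist a / 99"
    using dist_le_qh_dist[OF a in\<Omega>(1), of "1/100"] dist_le_qh_dist[OF a in\<Omega>(2), of "1/100"] dr r by auto
  \<comment> \<open>A Euclidean ball is convex, so the whole segment is within
    \<open>bdist a / 99\<close> of \<open>a\<close>. This gives distance at most
    \<open>1/98\<close>, within the range of the midpoint estimate.\<close>
  have c: "c t \<in> \<Omega>" "qh_dist \<Omega> a (c t) \<le> 1/10" if t: "t \<in> {0..1}" for t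
  proof -
    have "c t = (1 - t) *\<^sub>R p + t *\<^sub>R q"
      by (simp add: c_def algebra_simps)
    then have "c t \<in> closed_segment p q"
      using t by (auto simp: closed_segment_def)
    then have "c t \<in> cball a (bdist a / 99)"
      using near closed_segment_subset[OF _ _ convex_cball, of p a "bdist a / 99" q] by auto
    then have d: "dist a (c t) \<le> bdist a / 99" by simp
    show "c t \<in> \<Omega>"
      by (rule near_bounds(1)[OF a]) (use d bdist_pos[OF a] in simp)
    have "qh_dist \<Omega> a (c t) \<le> dist a (c t) / (bdist a - dist a (c t))"
      by (rule qh_dist_le[OF a]) (use d bdist_pos[OF a] in simp)
    also have "\<dots> \<le> (bdist a / 99) / (bdist a - bdist a / 99)"
      using d bdist_pos[OF a] by (intro frac_le) auto
    also have "\<dots> \<le> 1/10"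
      using bdist_pos[OF a] by (simp add: field_simps)
    finally show "qh_dist \<Omega> a (c t) \<le> 1/10" .
  qed
  have "continuous_on {0..1} (\<lambda>t. qh_dist \<Omega> a (c t))"
    by (rule continuous_on_compose2[OF qh_dist_continuous[OF a]])
      (auto simp: c_def[abs_def] intro!: continuous_intros c(1)[unfolded c_def])
  then obtain t0 where t0: "t0 \<in> {0..1}" "\<And>t. t \<in> {0..1} \<Longrightarrow> qh_dist \<Omega> a (c t) \<le> qh_dist \<Omega> a (c t0)"
    using continuous_attains_sup[of "{0..1::real}" "\<lambda>t. qh_dist \<Omega> a (c t)"] by auto
  have interior: "qh_dist \<Omega> a (c t) < qh_dist \<Omega> a (c t0)" if t: "0 < t" "t < 1" for t
  proof -
    \<comment> \<open>The largest \<open>h\<close> for which both \<open>t - h\<close> and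
      \<open>t + h\<close> remain in the unit interval.\<close>
    define h where "h = min t (1 - t)"
    have h: "0 < h" "t - h \<in> {0..1}" "t + h \<in> {0..1}" using t by (auto simp: h_def)
    have "c (t + h) - c (t - h) = ((t + h) - (t - h)) *\<^sub>R (q - p)"
      unfolding c_def scaleR_diff_left by simp
    then have ne: "c (t - h) \<noteq> c (t + h)" using h pq(3) by auto
    have "midpoint (c (t - h)) (c (t + h)) = c t"
      unfolding midpoint_eq_iff by (simp add: c_def algebra_simps)
    then show ?thesis
      using qh_dist_midpoint_less[OF a c(1)[OF h(2)] c(1)[OF h(3)] ne] t0 h c(2) by metis
  qed
  \<comment> \<open>The maximum sits at an end point and is at most \<open>r\<close>; strictness
    inside puts \<open>z\<close> into the open ball even when \<open>p\<close> and \<open>q\<close>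
    are on its boundary.\<close>
  have "t0 = 0 \<or> t0 = 1" using interior[of t0] t0(1) by force
  then have "qh_dist \<Omega> a (c t0) \<le> r" using ends dr by auto
  moreover obtain t where t: "0 < t" "t < 1" "z = c t"
    using z by (auto simp: in_segment c_def algebra_simps)
  ultimately have "z \<in> qh_ball \<Omega> a r"
    using interior[of t] c(1)[of t] by (auto simp: qh_ball_def)
  then show "z \<in> interior (qh_ball \<Omega> a r)"
    using interior_open[OF open_qh_ball[OF a]] by simp
qed

section \<open>Uniqueness of short geodesics\<close>

lemma qh_dist_le_0:
  assumes "x \<in> \<Omega>" "y \<in> \<Omega>" "qh_dist \<Omega> x y \<le> 0"
  shows "x = y"
  using dist_le_qh_dist[OF assms] by simp

text \<open>The midpoint of two such points would be strictly closer than \<open>u\<close> to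
  \<open>x\<close> and than \<open>v\<close> to \<open>y\<close>, against the triangle
  inequality.\<close>

lemma between_unique:
  assumes x: "x \<in> \<Omega>" and y: "y \<in> \<Omega>" and z: "z \<in> \<Omega>" "z' \<in> \<Omega>"
    and u: "qh_dist \<Omega> x z \<le> u" "qh_dist \<Omega> x z' \<le> u" "u \<le> 1/10"
    and v: "qh_dist \<Omega> y z \<le> v" "qh_dist \<Omega> y z' \<le> v" "v \<le> 1/10"
    and "u + v \<le> qh_dist \<Omega> x y"
  shows "z = z'"
proof (rule ccontr)
  assume ne: "z \<noteq> z'"
  have m: "midpoint z z' \<in> \<Omega>"
    using u by (intro midpoint_mem_domain[OF x z]) auto
  show False
    using qh_dist_midpoint_less[OF x z ne u] qh_dist_midpoint_less[OF y z ne v]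
      qh_dist_triangle[OF x m y] qh_dist_sym[OF m y] assms by simp
qed

text \<open>Points at clock value \<open>u\<close> on nearly shortest paths almost qualify. They
  stay in a compact ball inside \<Omega>, and a limit point qualifies.\<close>

lemma between_exists:
  assumes x: "x \<in> \<Omega>" and y: "y \<in> \<Omega>" and L: "qh_dist \<Omega> x y \<le> 1/10"
    and u: "0 \<le> u" "u \<le> qh_dist \<Omega> x y"
  obtains z where "z \<in> \<Omega>" "qh_dist \<Omega> x z \<le> u" "qh_dist \<Omega> y z \<le> qh_dist \<Omega> x y - u"
proof -
  let ?L = "qh_dist \<Omega> x y"
  have "\<exists>z. z \<in> \<Omega> \<and> qh_dist \<Omega> x z \<le> u \<and> qh_dist \<Omega> y z \<le> ?L - u + 1 / real (Suc n)" for n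
  proof -
    obtain g where g: "g \<in> qh_paths \<Omega> x y" "qh_length \<Omega> g < ?L + 1 / real (Suc n)"
      using qh_dist_approx[OF x y, of "1 / real (Suc n)"] by auto
    then obtain t where t: "t \<in> {0..1}" "clock g t = u"
      using clock_attained[OF g(1) u(1)] u(2) qh_dist_le_length[OF g(1)] order_trans by blast
    have g01: "g 0 = x" "g 1 = y"
      using g by (auto simp: qh_paths_def pathstart_def pathfinish_def)
    have gt: "g t \<in> \<Omega>" using qh_paths_mem[OF g(1)] t by auto
    have "qh_dist \<Omega> x (g t) \<le> u" "qh_dist \<Omega> (g t) y \<le> qh_length \<Omega> g - u"
      using qh_dist_le_clock[OF g(1), of 0 t] qh_dist_le_clock[OF g(1), of t 1] t g01 g(1) by auto
    then show ?thesis
      using gt g(2) qh_dist_sym[OF gt y] by (intro exI[of _ "g t"]) auto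
  qed
  then obtain z where z: "\<And>n. z n \<in> \<Omega>" "\<And>n. qh_dist \<Omega> x (z n) \<le> u"
    "\<And>n. qh_dist \<Omega> y (z n) \<le> ?L - u + 1 / real (Suc n)"
    by metis
  have "qh_dist \<Omega> x (z n) \<le> 1/9" for n
    using z(2)[of n] u L by linarith
  then have "z n \<in> cball x (bdist x / 8)" for n
    using dist_near[OF x z(1)] by simp
  then obtain l \<sigma> where l: "l \<in> cball x (bdist x / 8)" "strict_mono \<sigma>" "(z \<circ> \<sigma>) \<longlonglongrightarrow> l"
    using compact_cball[of x "bdist x / 8"] unfolding compact_def by metis
  have l\<Omega>: "l \<in> \<Omega>" using near_bounds(1)[OF x] l(1) by simp
  have "(\<lambda>n. ?L - u + 1 / real (Suc n)) \<longlonglongrightarrow> ?L - u + 0"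
    by (intro tendsto_intros LIMSEQ_Suc lim_const_over_n)
  then have lim: "(\<lambda>n. ?L - u + 1 / real (Suc (\<sigma> n))) \<longlonglongrightarrow> ?L - u"
    using LIMSEQ_subseq_LIMSEQ[OF _ l(2)] by (fastforce simp: o_def)
  show thesis
  proof (rule that[OF l\<Omega>])
    show "qh_dist \<Omega> x l \<le> u"
      by (rule qh_dist_limit_le[OF x _ l(3) l\<Omega> _ tendsto_const]) (simp_all add: z)
    show "qh_dist \<Omega> y l \<le> ?L - u"
      by (rule qh_dist_limit_le[OF y _ l(3) l\<Omega> _ lim]) (use z in simp_all)
  qed
qed

text \<open>On a piece of quasihyperbolic size \<delta> the boundary distance is nearly constant. So
  the Lipschitz bound passes to Euclidean length and back to \<open>qh_length\<close> at the cost of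
  a factor that tends to 1 with \<delta> tending to 0.\<close>

lemma qh_length_lipschitz_piece:
  assumes g: "g \<in> qh_paths \<Omega> x y" and st: "0 \<le> s" "s \<le> t" "t \<le> 1"
    and lip: "\<And>r r'. s \<le> r \<Longrightarrow> r \<le> r' \<Longrightarrow> r' \<le> t \<Longrightarrow> qh_dist \<Omega> (g r) (g r') \<le> L * (r' - r)"
    and L: "0 \<le> L" and \<delta>: "\<delta> = L * (t - s)" "\<delta> \<le> 1/10"
  shows "qh_length \<Omega> (subpath s t g) \<le> \<delta> / ((1 - 2 * \<delta>) * (1 - \<delta>))"
proof -
  define B where "B = bdist (g s)"
  have g\<Omega>: "g r \<in> \<Omega>" if "s \<le> r" "r \<le> t" for r
    using qh_paths_mem[OF g] st that by auto
  have B: "0 < B" using bdist_pos g\<Omega>[of s] st by (simp add: B_def)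
  have \<delta>0: "0 \<le> \<delta>" using L st \<delta> by simp
  have near: "dist (g s) (g r) \<le> B * (\<delta> / (1 - \<delta>))" if "s \<le> r" "r \<le> t" for r
  proof -
    have "L * (r - s) \<le> \<delta>" using that L \<delta> by (simp add: mult_left_mono)
    then show ?thesis
      unfolding B_def using that st lip[of s r] g\<Omega> \<delta> by (intro dist_le_qh_dist) auto
  qed
  have up: "bdist (g r) \<le> B / (1 - \<delta>)" if "s \<le> r" "r \<le> t" for r
  proof -
    have "bdist (g r) \<le> B + B * (\<delta> / (1 - \<delta>))"
      using near[OF that] bdist_lipschitz[of "g r" "g s"] by (simp add: B_def)
    also have "\<dots> = B / (1 - \<delta>)" using \<delta> by (simp add: field_simps)
    finally show ?thesis .
  qed
  have low: "B * ((1 - 2 * \<delta>) / (1 - \<delta>)) \<le> bdist (g r)" if "s \<le> r" "r \<le> t" for r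
  proof -
    have "B * ((1 - 2 * \<delta>) / (1 - \<delta>)) = B - B * (\<delta> / (1 - \<delta>))"
      using \<delta> by (simp add: field_simps)
    also have "\<dots> \<le> bdist (g r)"
      using near[OF that] bdist_lipschitz[of "g s" "g r"] by (simp add: B_def dist_commute)
    finally show ?thesis .
  qed
  have rg: "rectifiable_path g" using g by (simp add: qh_paths_def)
  have "curve_length (subpath s t g) 0 1 = curve_length g s t"
    using curve_length_subpath[OF rg st, of 1] curve_length_between[OF rg st] by simp
  also have "\<dots> \<le> (B / (1 - \<delta>) * (L / (1 - \<delta>))) * t - (B / (1 - \<delta>) * (L / (1 - \<delta>))) * s"
  proof (rule curve_length_le[OF st(2)])
    fix r r' assume r: "s \<le> r" "r \<le> r'" "r' \<le> t"
    have le: "L * (r' - r) \<le> \<delta>" unfolding \<delta> using r L by (intro mult_left_mono) auto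
    have "dist (g r) (g r') \<le> bdist (g r) * (L * (r' - r) / (1 - L * (r' - r)))"
      using r lip[of r r'] g\<Omega> le \<delta> by (intro dist_le_qh_dist) auto
    also have "\<dots> \<le> B / (1 - \<delta>) * (L * (r' - r) / (1 - \<delta>))"
      using up[of r] r le \<delta> \<delta>0 L B
      by (intro mult_mono frac_le divide_nonneg_nonneg mult_nonneg_nonneg) auto
    finally show "dist (g r) (g r') \<le>
        (B / (1 - \<delta>) * (L / (1 - \<delta>))) * r' - (B / (1 - \<delta>) * (L / (1 - \<delta>))) * r"
      by (simp add: algebra_simps diff_divide_distrib)
  qed
  also have "\<dots> = B / (1 - \<delta>) * (\<delta> / (1 - \<delta>))"
    unfolding \<delta>(1) by (simp add: algebra_simps diff_divide_distrib)
  finally have len: "curve_length (subpath s t g) 0 1 \<le> B / (1 - \<delta>) * (\<delta> / (1 - \<delta>))" .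
  have pos: "0 < B * ((1 - 2 * \<delta>) / (1 - \<delta>))" using B \<delta> by simp
  have "qh_length \<Omega> (subpath s t g) \<le> curve_length (subpath s t g) 0 1 / (B * ((1 - 2 * \<delta>) / (1 - \<delta>)))"
  proof (rule qh_length_le[OF qh_paths_subpath[OF g st] pos])
    fix z assume "z \<in> path_image (subpath s t g)"
    then obtain r where "s \<le> r" "r \<le> t" "z = g r"
      using st by (auto simp: path_image_subpath)
    then show "B * ((1 - 2 * \<delta>) / (1 - \<delta>)) \<le> bdist z" using low by simp
  qed
  also have "\<dots> \<le> (B / (1 - \<delta>) * (\<delta> / (1 - \<delta>))) / (B * ((1 - 2 * \<delta>) / (1 - \<delta>)))"
    using len pos by (intro divide_right_mono) auto
  also have "\<dots> = \<delta> / ((1 - 2 * \<delta>) * (1 - \<delta>))"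
  proof -
    have "(B / v * (\<delta> / v)) / (B * (w / v)) = \<delta> / (w * v)" if "v \<noteq> 0" "w \<noteq> 0" for v w :: real
      using that B by (simp add: field_simps)
    then show ?thesis using \<delta>(2) by simp
  qed
  finally show ?thesis .
qed

text \<open>Cut into \<open>N\<close> equal pieces and add up: the error factor is the same for all
  pieces and tends to 1 as \<open>N\<close> grows.\<close>

lemma qh_length_lipschitz:
  assumes g: "g \<in> qh_paths \<Omega> x y"
    and lip: "\<And>r r'. 0 \<le> r \<Longrightarrow> r \<le> r' \<Longrightarrow> r' \<le> 1 \<Longrightarrow> qh_dist \<Omega> (g r) (g r') \<le> L * (r' - r)"
    and L: "0 \<le> L" "L \<le> 1/10"
  shows "qh_length \<Omega> g \<le> L"
proof -
  have bound: "qh_length \<Omega> g \<le> L / ((1 - 2 * (L / real N)) * (1 - L / real N))" if N: "1 \<le> N" for N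
  proof -
    let ?\<delta> = "L / real N"
    let ?C = "?\<delta> / ((1 - 2 * ?\<delta>) * (1 - ?\<delta>))"
    have small: "?\<delta> \<le> 1/10"
      using N L frac_le[of L L 1 "real N"] by simp
    have "clock g (real n / real N) \<le> real n * ?C" if "n \<le> N" for n
      using that
    proof (induction n)
      case 0
      then show ?case using g by simp
    next
      case (Suc n)
      let ?s = "real n / real N" and ?t = "real (Suc n) / real N"
      have st: "0 \<le> ?s" "?s \<le> ?t" "?t \<le> 1"
        using Suc.prems N by (auto simp: divide_right_mono)
      have "?\<delta> = L * (?t - ?s)"
        using N by (simp add: field_simps)
      then have "qh_length \<Omega> (subpath ?s ?t g) \<le> ?C"
        using st by (intro qh_length_lipschitz_piece[OF g st _ L(1) _ small] lip) linarith+
      then show ?case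
        using Suc clock_diff[OF g st] by (simp add: algebra_simps add_divide_distrib)
    qed
    from this[of N] show ?thesis using N by simp
  qed
  have "(\<lambda>N. L / ((1 - 2 * (L / real N)) * (1 - L / real N))) \<longlonglongrightarrow> L / ((1 - 2 * 0) * (1 - 0))"
    by (intro tendsto_intros lim_const_over_n) simp
  then have "qh_length \<Omega> g \<le> L / ((1 - 2 * 0) * (1 - 0))"
    by (rule LIMSEQ_le_const) (intro exI[of _ 1] allI impI bound)
  then show ?thesis by simp
qed

text \<open>The points of the geodesic are chosen one by one by their distances to \<open>x\<close>
  and \<open>y\<close>; uniqueness of such points forces the choice to be Lipschitz, hence a path of
  the right length.\<close>

lemma short_geodesic:
  assumes x: "x \<in> \<Omega>" and y: "y \<in> \<Omega>" and L: "qh_dist \<Omega> x y \<le> 1/10"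
  obtains g where "qh_geodesic \<Omega> x y g" "\<And>t. t \<in> {0..1} \<Longrightarrow> g t \<in> \<Omega>"
    "\<And>t. t \<in> {0..1} \<Longrightarrow> qh_dist \<Omega> x (g t) \<le> t * qh_dist \<Omega> x y"
    "\<And>t. t \<in> {0..1} \<Longrightarrow> qh_dist \<Omega> y (g t) \<le> (1 - t) * qh_dist \<Omega> x y"
proof -
  define L where "L = qh_dist \<Omega> x y"
  have L0: "0 \<le> L" "L \<le> 1/10" using qh_dist_nonneg[OF x y] L by (auto simp: L_def)
  have tL: "0 \<le> t * L" "t * L \<le> L" if "t \<in> {0..1}" for t
    using that L0 mult_right_mono[of t 1 L] by auto
  have "\<exists>z. z \<in> \<Omega> \<and> qh_dist \<Omega> x z \<le> t * L \<and> qh_dist \<Omega> y z \<le> (1 - t) * L" if "t \<in> {0..1}" for t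
    using between_exists[OF x y L, of "t * L"] tL[OF that] unfolding L_def[symmetric]
    by (metis left_diff_distrib mult_1)
  then obtain g where g: "\<And>t. t \<in> {0..1} \<Longrightarrow> g t \<in> \<Omega>"
    "\<And>t. t \<in> {0..1} \<Longrightarrow> qh_dist \<Omega> x (g t) \<le> t * L"
    "\<And>t. t \<in> {0..1} \<Longrightarrow> qh_dist \<Omega> y (g t) \<le> (1 - t) * L"
    by metis
  have ends: "g 0 = x" "g 1 = y"
    using qh_dist_le_0[OF x g(1)[of 0]] qh_dist_le_0[OF y g(1)[of 1]] g(2)[of 0] g(3)[of 1] by auto
  \<comment> \<open>A point \<open>z\<close> between \<open>x\<close> and \<open>g t\<close> at
    distance \<open>s * L\<close> from \<open>x\<close> also satisfies the conditions on
    \<open>g s\<close>, so it is \<open>g s\<close>.\<close>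
  have lip: "qh_dist \<Omega> (g s) (g t) \<le> L * (t - s)" if st: "0 \<le> s" "s \<le> t" "t \<le> 1" for s t
  proof -
    have s: "s \<in> {0..1}" and t: "t \<in> {0..1}" using st by auto
    have dt: "qh_dist \<Omega> x (g t) = t * L"
      using g(2,3)[OF t] qh_dist_triangle[OF x g(1)[OF t] y] qh_dist_sym[OF y g(1)[OF t]]
      by (simp add: L_def algebra_simps)
    have "s * L \<le> t * L" using st L0 by (intro mult_right_mono) auto
    then obtain z where z: "z \<in> \<Omega>" "qh_dist \<Omega> x z \<le> s * L" "qh_dist \<Omega> (g t) z \<le> t * L - s * L"
      using between_exists[OF x g(1)[OF t], of "s * L"] dt tL[OF s] tL[OF t] L0 by auto
    have "qh_dist \<Omega> y z \<le> (1 - s) * L"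
      using qh_dist_triangle[OF y g(1)[OF t] z(1)] z(3) g(3)[OF t] by (simp add: algebra_simps)
    moreover have "(1 - s) * L \<le> 1/10" "s * L \<le> 1/10"
      using tL[of "1 - s"] tL[of s] s L0 by auto
    ultimately have "z = g s"
      using z g[OF s] by (intro between_unique[OF x y z(1) g(1)[OF s], of "s * L" "(1 - s) * L"])
        (auto simp: L_def algebra_simps)
    then show ?thesis
      using z(3) qh_dist_sym[OF g(1)[OF s] g(1)[OF t]] by (simp add: algebra_simps)
  qed
  \<comment> \<open>\<open>5/4\<close> is \<open>9/8\<close>, from the boundary distance near
    \<open>x\<close>, divided by \<open>9/10\<close>, the least value of
    \<open>1 - L * (t - s)\<close>.\<close>
  define C where "C = 5/4 * bdist x * L"
  have D: "dist (g s) (g t) \<le> C * t - C * s" if st: "0 \<le> s" "s \<le> t" "t \<le> 1" for s t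
  proof -
    have s: "s \<in> {0..1}" and t: "t \<in> {0..1}" using st by auto
    have le: "L * (t - s) \<le> L * 1" using st L0 by (intro mult_left_mono) auto
    have "dist (g s) (g t) \<le> bdist (g s) * (L * (t - s) / (1 - L * (t - s)))"
      using lip[OF st] le L0 by (intro dist_le_qh_dist g(1)[OF s] g(1)[OF t]) auto
    also have "\<dots> \<le> (9/8 * bdist x) * (L * (t - s) / (9/10))"
    proof (intro mult_mono frac_le)
      have "dist x (g s) \<le> bdist x / 8"
        using g(2)[OF s] tL[OF s] L0 by (intro dist_near[OF x g(1)[OF s]]) auto
      then show "bdist (g s) \<le> 9/8 * bdist x" by (rule near_bounds(3)[OF x])
    qed (use le L0 st bdist_pos[OF x] in auto)
    also have "\<dots> = C * t - C * s" by (simp add: C_def field_simps)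
    finally show ?thesis .
  qed
  have "continuous_on {0..1} g"
  proof (rule lipschitz_on_continuous_on[OF lipschitz_onI])
    show "0 \<le> C" using L0 bdist_pos[OF x] by (simp add: C_def)
    fix s t :: real assume "s \<in> {0..1}" "t \<in> {0..1}"
    then show "dist (g s) (g t) \<le> C * dist s t"
      using D[of s t] D[of t s] by (cases "s \<le> t") (auto simp: dist_real_def dist_commute algebra_simps)
  qed
  then have path: "g \<in> qh_paths \<Omega> x y"
    using rectifiable_pathI[of g "\<lambda>t. C * t", OF _ D] g(1) ends
    by (auto simp: qh_paths_def path_def path_image_def pathstart_def pathfinish_def)
  have "qh_length \<Omega> g \<le> L"
    by (rule qh_length_lipschitz[OF path lip L0])
  then have "qh_geodesic \<Omega> x y g"
    using path qh_dist_le_length[OF path] by (simp add: qh_geodesic_def L_def)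
  then show thesis using that g by (simp add: L_def)
qed

text \<open>Every geodesic is compared with the one from \<open>short_geodesic\<close>: where its
  clock shows \<open>v\<close>, its distances to \<open>x\<close> and \<open>y\<close> are at most
  \<open>v\<close> and \<open>L - v\<close>, which leaves only the point of \<open>g\<close> at
  \<open>v / L\<close>.\<close>

lemma short_geodesic_unique:
  assumes x: "x \<in> \<Omega>" and y: "y \<in> \<Omega>" and L: "qh_dist \<Omega> x y \<le> 1/10"
  shows "\<exists>g. qh_geodesic \<Omega> x y g \<and> (\<forall>h. qh_geodesic \<Omega> x y h \<longrightarrow> same_up_to_param g h)"
proof -
  define L where "L = qh_dist \<Omega> x y"
  have L0: "0 \<le> L" "L \<le> 1/10" using qh_dist_nonneg[OF x y] L by (auto simp: L_def)
  obtain g where geo: "qh_geodesic \<Omega> x y g" and g: "\<And>t. t \<in> {0..1} \<Longrightarrow> g t \<in> \<Omega>"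
    "\<And>t. t \<in> {0..1} \<Longrightarrow> qh_dist \<Omega> x (g t) \<le> t * L"
    "\<And>t. t \<in> {0..1} \<Longrightarrow> qh_dist \<Omega> y (g t) \<le> (1 - t) * L"
    using short_geodesic[OF x y L] unfolding L_def by metis
  have "same_up_to_param g h" if h_geo: "qh_geodesic \<Omega> x y h" for h
  proof -
    have h: "h \<in> qh_paths \<Omega> x y" and len: "qh_length \<Omega> h = L"
      using h_geo by (auto simp: qh_geodesic_def L_def)
    have h01: "h 0 = x" "h 1 = y"
      using h by (auto simp: qh_paths_def pathstart_def pathfinish_def)
    have h\<Omega>: "h t \<in> \<Omega>" if "t \<in> {0..1}" for t
      using qh_paths_mem[OF h] that by auto
    have c: "0 \<le> clock h t" "clock h t \<le> L" if "t \<in> {0..1}" for t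
      using clock_mono[OF h, of 0 t] clock_mono[OF h, of t 1] that h len by auto
    have hx: "qh_dist \<Omega> x (h t) \<le> clock h t" and hy: "qh_dist \<Omega> y (h t) \<le> L - clock h t"
      if t: "t \<in> {0..1}" for t
      using qh_dist_le_clock[OF h, of 0 t] qh_dist_le_clock[OF h, of t 1] t h01 h len
        qh_dist_sym[OF h\<Omega>[OF t] y] by auto
    \<comment> \<open>Continuity of \<open>\<phi>\<close> will come from this, as the distance to
      \<open>x\<close> is continuous.\<close>
    have clock_eq: "clock h t = qh_dist \<Omega> x (h t)" if t: "t \<in> {0..1}" for t
      using hx[OF t] hy[OF t] qh_dist_triangle[OF x h\<Omega>[OF t] y] qh_dist_sym[OF h\<Omega>[OF t] y]
      by (simp add: L_def)
    \<comment> \<open>If \<open>L = 0\<close>, division would give the constant 0, which does not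
      cover the unit interval; the identity does.\<close>
    define \<phi> where "\<phi> t = (if L = 0 then t else clock h t / L)" for t
    have \<phi>: "\<phi> t \<in> {0..1}" "\<phi> t * L = clock h t" if "t \<in> {0..1}" for t
      using c[OF that] that L0 by (auto simp: \<phi>_def divide_le_eq)
    have eq: "g (\<phi> t) = h t" if t: "t \<in> {0..1}" for t
    proof (rule between_unique[OF x y])
      show "qh_dist \<Omega> x (g (\<phi> t)) \<le> clock h t"
        using g(2)[OF \<phi>(1)[OF t]] \<phi>(2)[OF t] by simp
      show "qh_dist \<Omega> y (g (\<phi> t)) \<le> L - clock h t"
        using g(3)[OF \<phi>(1)[OF t]] \<phi>(2)[OF t] by (simp add: algebra_simps)
    qed (use g(1)[OF \<phi>(1)[OF t]] h\<Omega>[OF t] hx[OF t] hy[OF t] c[OF t] L0 in \<open>auto simp: L_def\<close>)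
    have "monotone_reparam \<phi>"
    proof (cases "L = 0")
      case True
      then have "\<phi> = (\<lambda>t. t)" by (simp add: \<phi>_def fun_eq_iff)
      then show ?thesis by (simp add: monotone_reparam_def mono_on_def)
    next
      case False
      then have \<phi>L: "\<phi> t = clock h t / L" for t by (simp add: \<phi>_def)
      have "continuous_on {0..1} h"
        using h by (simp add: qh_paths_def rectifiable_path_def path_def)
      then have "continuous_on {0..1} (\<lambda>t. qh_dist \<Omega> x (h t) / L)"
        using h\<Omega> False
        by (intro continuous_on_divide continuous_on_const continuous_on_compose2[OF qh_dist_continuous[OF x]])
          auto
      then have "continuous_on {0..1} \<phi>"
        by (rule continuous_on_eq) (simp add: \<phi>L clock_eq)
      moreover have "mono_on {0..1} \<phi>"
        using clock_mono[OF h] L0 by (auto simp: mono_on_def \<phi>L intro!: divide_right_mono)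
      moreover have "\<phi> ` {0..1} = {0..1}"
      proof
        show "\<phi> ` {0..1} \<subseteq> {0..1}" using \<phi>(1) by blast
        show "{0..1} \<subseteq> \<phi> ` {0..1}"
        proof
          fix v :: real assume v: "v \<in> {0..1}"
          then have "0 \<le> v * L" "v * L \<le> qh_length \<Omega> h"
            using L0 len mult_right_mono[of v 1 L] by auto
          then obtain t where "t \<in> {0..1}" "clock h t = v * L"
            by (rule clock_attained[OF h])
          then show "v \<in> \<phi> ` {0..1}"
            using False by (intro image_eqI[of _ _ t]) (simp_all add: \<phi>L)
        qed
      qed
      ultimately show ?thesis by (simp add: monotone_reparam_def)
    qed
    moreover have "monotone_reparam (\<lambda>t. t)"
      by (simp add: monotone_reparam_def mono_on_def)
    ultimately show ?thesis
      unfolding same_up_to_param_def using eq by blast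
  qed
  then show ?thesis using geo by blast
qed

end

theorem theorem1p1:
  fixes \<Omega> :: "(real ^ 'n) set"
  assumes "CARD('n) \<ge> 2"
    and "open \<Omega>" and "connected \<Omega>" and "\<Omega> \<noteq> {}" and "\<Omega> \<noteq> UNIV"
  shows "(\<forall>a\<in>\<Omega>. \<forall>r. 0 < r \<and> r < 1 / 100 \<longrightarrow> strictly_convex (qh_ball \<Omega> a r)) \<and>
    (\<forall>x\<in>\<Omega>. \<forall>y\<in>\<Omega>. qh_dist \<Omega> x y < 1 / 50 \<longrightarrow>
       (\<exists>g. qh_geodesic \<Omega> x y g \<and> (\<forall>h. qh_geodesic \<Omega> x y h \<longrightarrow> same_up_to_param g h)))"
proof -
  interpret qh_domain \<Omega>
    using assms by unfold_locales
  \<comment> \<open>Distances below \<open>1/50\<close> are within the bound \<open>1/10\<close> for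
    unique geodesics.\<close>
  show ?thesis
    using strictly_convex_qh_ball short_geodesic_unique by simp
qed

end
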